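(* Let $V$ be a finite-dimensional real Hilbert space, let $\mathbf A=(\delta^A:A_1\to A_0,\gtrdot,\lessdot)$ be a crossed module of Banach algebras, and let $(\alpha,\gamma)$ be a continuous 2-connection on $V$ valued in $\mathbf A$. Let $\widetilde\alpha:E_0(V)\to A_0$ and $\widetilde\gamma:E_1(V)\to A_1$ be the unique continuous algebra morphisms with $\alpha=\widetilde\alpha\circ\zeta$ and $\gamma=\widetilde\gamma\circ Z$, and extend $\widetilde\gamma$ unitally to $\mathbb R\oplus E_1(V)\to\hat A_1$. Then for every smooth surface $X:[s_-,s_+]\times[t_-,t_+]\to V$, $$\widehat H^{\alpha,\gamma}(X)=\widetilde\gamma\big(\widehat R(X)\big).$$
   Context: Algebraic setup. $V$ has orthonormal basis $e_1,\dots,e_d$. $T_0(V)=\bigoplus_{n\ge0}V^{\otimes n}$ is the tensor algebra (product $\cdot$, unit $1$), $V^{\otimes n}$ having the Hilbert structure in which the words $e_{i_1}\cdots e_{i_n}$ are orthonormal; $\Lambda^2V$ has orthonormal basis $e_i\wedge e_j$ ($i<j$). Let $\overline T_1(V)=T_0(V)\otimes\Lambda^2V\otimes T_0(V)=\bigoplus_{n\ge2}\bigoplus_{k=0}^{n-2}V^{\otimes k}\otimes\Lambda^2V\otimes V^{\otimes(n-k-2)}$ (the part indexed by $n$ is "level $n$"), with the Hilbert structure making $e_{q_1}\cdots e_{q_k}\otimes(e_i\wedge e_j)\otimes e_{q_{k+1}}\cdots e_{q_{n-2}}$ orthonormal, with left/right $T_0(V)$-actions by multiplication on the outer factors (written $a\cdot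 E$, $E\cdot a$), and with $\delta:\overline T_1(V)\to T_0(V)$, $\delta(a\otimes(v\wedge w)\otimes b)=a\cdot(v\cdot w-w\cdot v)\cdot b$. The Peiffer subspace $\mathrm{Pf}$ is the span of all $\delta(E)\cdot F-E\cdot\delta(F)$; $T_1(V)=\overline T_1(V)/\mathrm{Pf}$, whose level-$n$ part $T_1^{(n)}(V)$ is identified with the orthogonal complement of the level-$n$ part of $\mathrm{Pf}$ and normed accordingly. The actions and $\delta$ descend to $T_1(V)$, which is an algebra with product $E*F=\delta(E)\cdot F=E\cdot\delta(F)$. Superscript $(k)$ denotes the level-$k$ component. $E_0(V)=\{a\in\prod_{n\ge0}V^{\otimes n}:\sum_k\lambda^k\|a^{(k)}\|<\infty\ \forall\lambda>0\}$ and $E_1(V)=\{E\in\prod_{n\ge2}T_1^{(n)}(V):\sum_k\lambda^k\|E^{(k)}\|<\infty\ \forall\lambda>0\}$, with the (locally $m$-convex) topologies generated by these seminorms; $\mathbf E(V)=(\delta:E_1(V)\to E_0(V),\cdot,\cdot)$. The universal 2-connection is $\zeta:V\to E_0(V)$ the inclusion and $Z:\Lambda^2V\to E_1(V)$, $v\wedge w\mapsto$ class of $1\otimes(v\wedge w)\otimes1$. Elements of $\mathbb R\oplus\prod_{n\ge2}T_1^{(n)}(V)$ multiply by $(\lambda,E)*(\mu,F)=(\lambda\mu,\lambda F+\mu E+E*F)$; an invertible $g\in\prod_nV^{\otimes n}$ acts by $g\triangleright(\lambda,E)=(\lambda,g\cdot E\cdot g^{-1})$. Crossed modules of algebras. $\mathbf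 A=(\delta^A:A_1\to A_0,\gtrdot,\lessdot)$ consists of a unital algebra $A_0$, an algebra $A_1$ which is an $A_0$-bimodule (actions $\gtrdot,\lessdot$) with $a\gtrdot(E*E')=(a\gtrdot E)*E'$, $(E*E')\lessdot a=E*(E'\lessdot a)$, $(E\lessdot a)*(a'\gtrdot E')=E*((aa')\gtrdot E')=(E\lessdot(aa'))*E'$, and an algebra morphism $\delta^A$ with $\delta^A(a\gtrdot E)=a\,\delta^A(E)$, $\delta^A(E\lessdot a)=\delta^A(E)a$, $\delta^A(E)\gtrdot E'=E*E'=E\lessdot\delta^A(E')$. It is a crossed module of Banach algebras if $A_0,A_1$ are Banach algebras, $\delta^A$ is continuous and $\|a\gtrdot E\|,\|E\lessdot a\|\le\|a\|\|E\|$. A 2-connection is a pair of linear maps $\alpha:V\to A_0$, $\gamma:\Lambda^2V\to A_1$ with $\delta^A(\gamma(v\wedge w))=\alpha(v)\alpha(w)-\alpha(w)\alpha(v)$; continuous if both are continuous. For such data the paper shows the continuous morphisms $\widetilde\alpha,\widetilde\gamma$ above exist and are unique. $\hat A_1=\mathbb R\oplus A_1$ is the unitalization, with invertible $a\in A_0$ acting by $a\triangleright(\lambda,E)=(\lambda,a\gtrdot E\lessdot a^{-1})$; the unital extension of $\widetilde\gamma$ is $(\lambda,E)\mapsto(\lambda,\widetilde\gamma(E))$. Paths and surfaces. For smooth $x:[a,b]\to V$, the parallel transport $F^\alpha(x)=F_b$ solves $\frac{d}{dt}F_t=F_t\,\alpha(\dot x_t)$, $F_a=1$; the path signature is $S(x)=1+\sum_{n\ge1}\int_{a<u_1<\dots<u_n<b}dx_{u_1}\cdots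 dx_{u_n}$ (it lies in $E_0(V)$). For smooth $X:[s_-,s_+]\times[t_-,t_+]\to V$ with coordinates $X^i$, the tail path $x^{s,t}:[0,(s-s_-)+(t-t_-)]\to V$ is $x^{s,t}_u=X_{u+s_-,t_-}$ for $u\le s-s_-$ and $x^{s,t}_u=X_{s,u-(s-s_-)+t_-}$ otherwise, and $J_{s,t}(X)=\sum_{i<j}(\partial_sX^i\partial_tX^j-\partial_sX^j\partial_tX^i)(s,t)\,e_i\wedge e_j$. The surface holonomy is $\widehat H^{\alpha,\gamma}(X)=\widehat H_{s_+,t_+}$ where $\partial_t\widehat H_{s,t}=\widehat H_{s,t}*\int_{s_-}^{s}F^\alpha(x^{s',t})\triangleright\gamma(J_{s',t}(X))\,ds'$, $\widehat H_{s,t_-}=1$. The surface signature is $\widehat R(X)=\widehat R_{s_+,t_+}(X)$ where $\partial_t\widehat R_{s,t}=\widehat R_{s,t}*\int_{s_-}^sS(x^{s',t})\triangleright J_{s',t}(X)\,ds'$, $\widehat R_{s,t_-}=1$ (solved level by level, $J$ viewed in $T_1^{(2)}(V)=\Lambda^2V$); it is known to lie in $\mathbb R\oplus E_1(V)$.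
   Formalization: The extension (α̃, γ̃) is taken to be a continuous morphism of crossed modules E(V) → A (α̃ unital, compatible with δ and with both actions); as bare continuous algebra morphisms extending (α, γ) they are not unique and the identity can fail. *)

theory Defs
  imports "HOL-Analysis.Analysis"
begin

section \<open>Tensor algebra T0(V), V = R^d with orthonormal basis e_0..e_(d-1)\<close>

text \<open>An element of prod_n V^(tensor n) is a coefficient function on words (lists of basis
indices). Only words with letters < d are meaningful.\<close>

type_synonym t0 = "nat list \<Rightarrow> real"

text \<open>Basis element  u (x) (e_i wedge e_j) (x) v  of the bar-T1(V), encoded as (u,(i,j),v), i<j.\<close>
type_synonym tb = "nat list \<times> (nat \<times> nat) \<times> nat list"
type_synonym t1 = "tb \<Rightarrow> real"

definition valid0 :: "nat \<Rightarrow> nat list \<Rightarrow> bool" where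
  "valid0 d w \<longleftrightarrow> set w \<subseteq> {..<d}"

definition valid1 :: "nat \<Rightarrow> tb \<Rightarrow> bool" where
  "valid1 d b \<longleftrightarrow> (case b of (u,(i,j),v) \<Rightarrow> set u \<subseteq> {..<d} \<and> set v \<subseteq> {..<d} \<and> i < j \<and> j < d)"

definition level1 :: "tb \<Rightarrow> nat" where
  "level1 b = (case b of (u,p,v) \<Rightarrow> length u + length v + 2)"

definition words :: "nat \<Rightarrow> nat \<Rightarrow> nat list set" where
  "words d k = {w. length w = k \<and> valid0 d w}"

definition basis1 :: "nat \<Rightarrow> nat \<Rightarrow> tb set" where
  "basis1 d n = {b. valid1 d b \<and> level1 b = n}"

definition one0 :: t0 where
  "one0 w = (if w = [] then 1 else 0)"

definition mul0 :: "t0 \<Rightarrow> t0 \<Rightarrow> t0" where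
  "mul0 a b w = (\<Sum>k\<le>length w. a (take k w) * b (drop k w))"

definition inv0 :: "t0 \<Rightarrow> t0" where
  "inv0 a = (THE b. mul0 a b = one0 \<and> mul0 b a = one0)"

definition lact :: "t0 \<Rightarrow> t1 \<Rightarrow> t1" where
  "lact a E b = (case b of (u,p,v) \<Rightarrow> (\<Sum>k\<le>length u. a (take k u) * E (drop k u, p, v)))"

definition ract :: "t1 \<Rightarrow> t0 \<Rightarrow> t1" where
  "ract E a b = (case b of (u,p,v) \<Rightarrow> (\<Sum>k\<le>length v. E (u, p, take k v) * a (drop k v)))"

definition delta :: "t1 \<Rightarrow> t0" where
  "delta E w = (\<Sum>k<length w - 1.
      (let u = take k w; i = w ! k; j = w ! (k+1); v = drop (k+2) w in
        if i < j then E (u,(i,j),v) else if j < i then - E (u,(j,i),v) else 0))"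

definition mul1 :: "t1 \<Rightarrow> t1 \<Rightarrow> t1" where
  "mul1 E F = lact (delta E) F"

definition T1bar :: "nat \<Rightarrow> t1 set" where
  "T1bar d = {E. finite {b. E b \<noteq> 0} \<and> (\<forall>b. \<not> valid1 d b \<longrightarrow> E b = 0)}"

inductive_set Pf :: "nat \<Rightarrow> t1 set" for d :: nat where
  Pf_zero: "(\<lambda>b. 0) \<in> Pf d"
| Pf_gen: "E \<in> T1bar d \<Longrightarrow> F \<in> T1bar d \<Longrightarrow> (\<lambda>b. lact (delta E) F b - ract E (delta F) b) \<in> Pf d"
| Pf_add: "P \<in> Pf d \<Longrightarrow> Q \<in> Pf d \<Longrightarrow> (\<lambda>b. P b + Q b) \<in> Pf d"
| Pf_scale: "P \<in> Pf d \<Longrightarrow> (\<lambda>b. c * P b) \<in> Pf d"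

definition Pfn :: "nat \<Rightarrow> nat \<Rightarrow> t1 set" where
  "Pfn d n = {P \<in> Pf d. \<forall>b. level1 b \<noteq> n \<longrightarrow> P b = 0}"

definition norm0 :: "nat \<Rightarrow> nat \<Rightarrow> t0 \<Rightarrow> real" where
  "norm0 d k a = sqrt (\<Sum>w\<in>words d k. (a w)\<^sup>2)"

text \<open>norm of the class of the level-n component of E in T1^(n) = (level-n part of bar-T1)/Pf^(n),
 identified with the orthogonal complement of Pf^(n): the norm of the orthogonal projection,
 i.e. the distance of E^(n) to Pf^(n).\<close>
definition norm1 :: "nat \<Rightarrow> nat \<Rightarrow> t1 \<Rightarrow> real" where
  "norm1 d n E = Inf {sqrt (\<Sum>b\<in>basis1 d n. (E b - P b)\<^sup>2) | P. P \<in> Pfn d n}"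

text \<open>E and F represent the same element of prod_n T1^(n)\<close>
definition equiv1 :: "nat \<Rightarrow> t1 \<Rightarrow> t1 \<Rightarrow> bool" where
  "equiv1 d E F \<longleftrightarrow> (\<forall>n. (\<lambda>b. if level1 b = n then E b - F b else 0) \<in> Pfn d n)"

definition E0 :: "nat \<Rightarrow> t0 set" where
  "E0 d = {a. (\<forall>w. \<not> valid0 d w \<longrightarrow> a w = 0) \<and> (\<forall>l>0. summable (\<lambda>k. l ^ k * norm0 d k a))}"

definition sn0 :: "nat \<Rightarrow> real \<Rightarrow> t0 \<Rightarrow> real" where
  "sn0 d l a = (\<Sum>k. l ^ k * norm0 d k a)"

definition E1 :: "nat \<Rightarrow> t1 set" where
  "E1 d = {E. (\<forall>b. \<not> valid1 d b \<longrightarrow> E b = 0) \<and> (\<forall>l>0. summable (\<lambda>k. l ^ k * norm1 d k E))}"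

definition sn1 :: "nat \<Rightarrow> real \<Rightarrow> t1 \<Rightarrow> real" where
  "sn1 d l E = (\<Sum>k. l ^ k * norm1 d k E)"

definition top0 :: "nat \<Rightarrow> t0 topology" where
  "top0 d = topology_generated_by
     {{b \<in> E0 d. sn0 d l (\<lambda>w. b w - a w) < r} | a l r. a \<in> E0 d \<and> l > 0 \<and> r > 0}"

definition top1 :: "nat \<Rightarrow> t1 topology" where
  "top1 d = topology_generated_by
     {{F \<in> E1 d. sn1 d l (\<lambda>b. F b - E b) < r} | E l r. E \<in> E1 d \<and> l > 0 \<and> r > 0}"

definition zeta :: "nat \<Rightarrow> t0" where
  "zeta i w = (if w = [i] then 1 else 0)"

definition Zc :: "nat \<Rightarrow> nat \<Rightarrow> t1" where
  "Zc i j b = (if b = ([],(i,j),[]) then 1 else 0)"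

definition ainv :: "'a::ring_1 \<Rightarrow> 'a" where
  "ainv a = (THE b. a * b = 1 \<and> b * a = 1)"

definition xmod_banach ::
  "('b::{real_normed_algebra,banach} \<Rightarrow> 'a::{real_normed_algebra,real_algebra_1,banach})
    \<Rightarrow> ('a \<Rightarrow> 'b \<Rightarrow> 'b) \<Rightarrow> ('b \<Rightarrow> 'a \<Rightarrow> 'b) \<Rightarrow> bool" where
  "xmod_banach dA l r \<longleftrightarrow>
     bounded_linear dA \<and> (\<forall>E F. dA (E * F) = dA E * dA F) \<and>
     (\<forall>a. linear (l a)) \<and> (\<forall>E. linear (\<lambda>a. l a E)) \<and>
     (\<forall>a. linear (\<lambda>E. r E a)) \<and> (\<forall>E. linear (r E)) \<and>
     (\<forall>a a' E. l (a * a') E = l a (l a' E)) \<and>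
     (\<forall>a a' E. r E (a * a') = r (r E a) a') \<and>
     (\<forall>a a' E. r (l a E) a' = l a (r E a')) \<and>
     (\<forall>a E E'. l a (E * E') = l a E * E') \<and>
     (\<forall>a E E'. r (E * E') a = E * r E' a) \<and>
     (\<forall>a a' E E'. r E a * l a' E' = E * l (a * a') E' \<and> E * l (a * a') E' = r E (a * a') * E') \<and>
     (\<forall>a E. dA (l a E) = a * dA E) \<and> (\<forall>a E. dA (r E a) = dA E * a) \<and>
     (\<forall>E E'. l (dA E) E' = E * E' \<and> r E (dA E') = E * E') \<and>
     (\<forall>a E. norm (l a E) \<le> norm a * norm E) \<and> (\<forall>a E. norm (r E a) \<le> norm E * norm a)"

text \<open>2-connection given by its values on the basis: alpha(e_i) = alp i, gamma(e_i wedge e_j) = gam i j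
  (linear maps on finite-dimensional spaces, hence automatically continuous).\<close>
definition two_connection :: "nat \<Rightarrow> ('b::{real_normed_algebra,banach} \<Rightarrow> 'a::{real_normed_algebra,real_algebra_1,banach})
    \<Rightarrow> (nat \<Rightarrow> 'a) \<Rightarrow> (nat \<Rightarrow> nat \<Rightarrow> 'b) \<Rightarrow> bool" where
  "two_connection d dA alp gam \<longleftrightarrow>
     (\<forall>i j. i < j \<and> j < d \<longrightarrow> dA (gam i j) = alp i * alp j - alp j * alp i)"

text \<open>(alpha~, gamma~) : E(V) -> A continuous morphism of crossed modules extending (alpha, gamma);
 gamma~ is given on representatives and must be well defined on classes modulo Pf.\<close>
definition ext_morphism ::
  "nat \<Rightarrow> ('b::{real_normed_algebra,banach} \<Rightarrow> 'a::{real_normed_algebra,real_algebra_1,banach})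
    \<Rightarrow> ('a \<Rightarrow> 'b \<Rightarrow> 'b) \<Rightarrow> ('b \<Rightarrow> 'a \<Rightarrow> 'b) \<Rightarrow> (nat \<Rightarrow> 'a) \<Rightarrow> (nat \<Rightarrow> nat \<Rightarrow> 'b)
    \<Rightarrow> (t0 \<Rightarrow> 'a) \<Rightarrow> (t1 \<Rightarrow> 'b) \<Rightarrow> bool" where
  "ext_morphism d dA l r alp gam atl gt \<longleftrightarrow>
     (\<forall>a\<in>E0 d. \<forall>b\<in>E0 d. \<forall>c. atl (\<lambda>w. c * a w + b w) = c *\<^sub>R atl a + atl b) \<and>
     (\<forall>a\<in>E0 d. \<forall>b\<in>E0 d. atl (mul0 a b) = atl a * atl b) \<and> atl one0 = 1 \<and>
     continuous_map (top0 d) euclidean atl \<and>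
     (\<forall>i<d. atl (zeta i) = alp i) \<and>
     (\<forall>E\<in>E1 d. \<forall>F\<in>E1 d. equiv1 d E F \<longrightarrow> gt E = gt F) \<and>
     (\<forall>E\<in>E1 d. \<forall>F\<in>E1 d. \<forall>c. gt (\<lambda>b. c * E b + F b) = c *\<^sub>R gt E + gt F) \<and>
     (\<forall>E\<in>E1 d. \<forall>F\<in>E1 d. gt (mul1 E F) = gt E * gt F) \<and>
     continuous_map (top1 d) euclidean gt \<and>
     (\<forall>i j. i < j \<and> j < d \<longrightarrow> gt (Zc i j) = gam i j) \<and>
     (\<forall>E\<in>E1 d. dA (gt E) = atl (delta E)) \<and>
     (\<forall>a\<in>E0 d. \<forall>E\<in>E1 d. gt (lact a E) = l (atl a) (gt E) \<and> gt (ract E a) = r (gt E) (atl a))"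

fun Ck :: "nat \<Rightarrow> (real \<times> real) set \<Rightarrow> (real \<times> real \<Rightarrow> real) \<Rightarrow> bool" where
  "Ck 0 U f = continuous_on U f"
| "Ck (Suc k) U f = ((\<forall>z\<in>U. f differentiable (at z)) \<and>
      Ck k U (\<lambda>z. frechet_derivative f (at z) (1,0)) \<and> Ck k U (\<lambda>z. frechet_derivative f (at z) (0,1)))"

text \<open>X i is the i-th coordinate of the surface; smooth = C^infinity on an open neighbourhood\<close>
definition smooth_surface :: "nat \<Rightarrow> real \<Rightarrow> real \<Rightarrow> real \<Rightarrow> real \<Rightarrow> (nat \<Rightarrow> real \<times> real \<Rightarrow> real) \<Rightarrow> bool" where
  "smooth_surface d sm sp tm tp X \<longleftrightarrow>
     (\<exists>U. open U \<and> {sm..sp} \<times> {tm..tp} \<subseteq> U \<and> (\<forall>i<d. \<forall>k. Ck k U (X i)))"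

definition dS :: "(nat \<Rightarrow> real \<times> real \<Rightarrow> real) \<Rightarrow> nat \<Rightarrow> real \<times> real \<Rightarrow> real" where
  "dS X i z = frechet_derivative (X i) (at z) (1,0)"

definition dT :: "(nat \<Rightarrow> real \<times> real \<Rightarrow> real) \<Rightarrow> nat \<Rightarrow> real \<times> real \<Rightarrow> real" where
  "dT X i z = frechet_derivative (X i) (at z) (0,1)"

text \<open>coefficient of e_i wedge e_j (i<j) in J_{s,t}(X)\<close>
definition Jco :: "(nat \<Rightarrow> real \<times> real \<Rightarrow> real) \<Rightarrow> nat \<Rightarrow> nat \<Rightarrow> real \<times> real \<Rightarrow> real" where
  "Jco X i j z = dS X i z * dT X j z - dS X j z * dT X i z"

definition tail_len :: "real \<Rightarrow> real \<Rightarrow> real \<Rightarrow> real \<Rightarrow> real" where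
  "tail_len sm tm s t = (s - sm) + (t - tm)"

definition tail_path :: "(nat \<Rightarrow> real \<times> real \<Rightarrow> real) \<Rightarrow> real \<Rightarrow> real \<Rightarrow> real \<Rightarrow> real \<Rightarrow> nat \<Rightarrow> real \<Rightarrow> real" where
  "tail_path X sm tm s t i u =
     (if u \<le> s - sm then X i (u + sm, tm) else X i (s, u - (s - sm) + tm))"

definition ptrans :: "nat \<Rightarrow> (nat \<Rightarrow> 'a::{real_normed_algebra,real_algebra_1,banach}) \<Rightarrow> real
    \<Rightarrow> (nat \<Rightarrow> real \<Rightarrow> real) \<Rightarrow> 'a" where
  "ptrans d alp L x = (THE y. \<exists>F. F 0 = 1 \<and> F L = y \<and> continuous_on {0..L} F \<and>
     (\<exists>S. finite S \<and> (\<forall>u\<in>{0..L} - S.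
        (F has_vector_derivative (F u * (\<Sum>i<d. vector_derivative (x i) (at u within {0..L}) *\<^sub>R alp i)))
          (at u within {0..L}))))"

text \<open>iterated integrals; sigr on reversed words\<close>
fun sigr :: "nat \<Rightarrow> real \<Rightarrow> (nat \<Rightarrow> real \<Rightarrow> real) \<Rightarrow> real \<Rightarrow> nat list \<Rightarrow> real" where
  "sigr d L x t [] = 1"
| "sigr d L x t (i # w) = (if i < d then
      integral {0..t} (\<lambda>u. sigr d L x u w * vector_derivative (x i) (at u within {0..L})) else 0)"

text \<open>path signature S(x) of x : [0,L] -> V: coefficient of the word w is the iterated integral
  int_{0<u_1<...<u_n<L} dx^{w_1}_{u_1} ... dx^{w_n}_{u_n}\<close>
definition sig :: "nat \<Rightarrow> real \<Rightarrow> (nat \<Rightarrow> real \<Rightarrow> real) \<Rightarrow> t0" where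
  "sig d L x w = sigr d L x L (rev w)"

definition umul :: "real \<times> 'b::real_algebra \<Rightarrow> real \<times> 'b \<Rightarrow> real \<times> 'b" where
  "umul x y = (case x of (lam, E) \<Rightarrow> case y of (mu, F) \<Rightarrow>
      (lam * mu, lam *\<^sub>R F + mu *\<^sub>R E + E * F))"

text \<open>multiplication in R (+) prod_n T1^(n), on representatives\<close>
definition umul1 :: "real \<times> t1 \<Rightarrow> real \<times> t1 \<Rightarrow> real \<times> t1" where
  "umul1 x y = (case x of (lam, E) \<Rightarrow> case y of (mu, F) \<Rightarrow>
      (lam * mu, \<lambda>b. lam * F b + mu * E b + mul1 E F b))"

definition Hhat :: "nat \<Rightarrow> (nat \<Rightarrow> 'a::{real_normed_algebra,real_algebra_1,banach})
    \<Rightarrow> (nat \<Rightarrow> nat \<Rightarrow> 'b::{real_normed_algebra,banach})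
    \<Rightarrow> ('a \<Rightarrow> 'b \<Rightarrow> 'b) \<Rightarrow> ('b \<Rightarrow> 'a \<Rightarrow> 'b)
    \<Rightarrow> real \<Rightarrow> real \<Rightarrow> real \<Rightarrow> real \<Rightarrow> (nat \<Rightarrow> real \<times> real \<Rightarrow> real) \<Rightarrow> real \<times> 'b" where
  "Hhat d alp gam l r sm sp tm tp X =
    (let G = (\<lambda>t. integral {sm..sp} (\<lambda>s'.
               let F = ptrans d alp (tail_len sm tm s' t) (tail_path X sm tm s' t)
               in r (l F (\<Sum>i<d. \<Sum>j<d. if i < j then Jco X i j (s',t) *\<^sub>R gam i j else 0)) (ainv F)))
     in THE y. \<exists>H. H tm = (1, 0) \<and> H tp = y \<and>
          (\<forall>t\<in>{tm..tp}. (H has_vector_derivative umul (H t) (0, G t)) (at t within {tm..tp})))"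

definition Jt1 :: "nat \<Rightarrow> (nat \<Rightarrow> real \<times> real \<Rightarrow> real) \<Rightarrow> real \<times> real \<Rightarrow> t1" where
  "Jt1 d X z b = (case b of (u,(i,j),v) \<Rightarrow>
      if u = [] \<and> v = [] \<and> i < j \<and> j < d then Jco X i j z else 0)"

definition Rhat :: "nat \<Rightarrow> real \<Rightarrow> real \<Rightarrow> real \<Rightarrow> real \<Rightarrow> (nat \<Rightarrow> real \<times> real \<Rightarrow> real) \<Rightarrow> real \<times> t1" where
  "Rhat d sm sp tm tp X =
    (let G = (\<lambda>t b. integral {sm..sp} (\<lambda>s'.
               let g = sig d (tail_len sm tm s' t) (tail_path X sm tm s' t)
               in ract (lact g (Jt1 d X (s',t))) (inv0 g) b))
     in THE y. \<exists>R. R tm = (1, \<lambda>b. 0) \<and> R tp = y \<and>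
          (\<forall>t\<in>{tm..tp}.
             ((\<lambda>t. fst (R t)) has_real_derivative fst (umul1 (R t) (0, G t))) (at t within {tm..tp}) \<and>
             (\<forall>b. ((\<lambda>t. snd (R t) b) has_real_derivative snd (umul1 (R t) (0, G t)) b) (at t within {tm..tp}))))"

definition uext :: "(t1 \<Rightarrow> 'b) \<Rightarrow> real \<times> t1 \<Rightarrow> real \<times> 'b" where
  "uext g x = (fst x, g (snd x))"

end

theory Submission
  imports Defs
begin

text \<open>A continuous morphism is determined by its values on basis elements, as a series converging
  uniformly over families of coefficients that decay super-exponentially in the level. It therefore
  commutes with derivatives and integrals of such families. The signature of the tail path solves a
  linear equation in the tensor algebra, and so does the boundary \<open>1 + \<delta>(R)\<close> of the surface
  signature \<open>R\<close>, which in turn is an integral over its boundary; solutions of linear equations with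
  rapidly decreasing data decrease rapidly. Hence the image of the path signature solves the equation
  of parallel transport, the image of the surface signature solves the equation of surface holonomy,
  and both equations have unique solutions.\<close>

section \<open>Rapidly decreasing families over a graded index set\<close>

definition basis_vec :: "'i \<Rightarrow> 'i \<Rightarrow> real" where
  "basis_vec b x = (if x = b then 1 else 0)"

locale graded_index =
  fixes valid :: "'i \<Rightarrow> bool" and level :: "'i \<Rightarrow> nat" and growth :: nat
  assumes finite_level: "finite {b. valid b \<and> level b = n}"
    and card_level_le: "card {b. valid b \<and> level b = n} \<le> growth ^ n"
    and growth_pos: "0 < growth"
begin

text \<open>Levels grow at most geometrically and every radius \<open>\<rho>\<close> is allowed, so that bounding single
  coefficients is as strong as bounding their sums over the levels.\<close>

definition uniformly_rapid :: "'t set \<Rightarrow> ('t \<Rightarrow> 'i \<Rightarrow> real) \<Rightarrow> bool" where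
  "uniformly_rapid T x \<longleftrightarrow> (\<forall>t\<in>T. \<forall>b. \<not> valid b \<longrightarrow> x t b = 0)
     \<and> (\<forall>\<rho>>0. \<exists>B. \<forall>t\<in>T. \<forall>b. \<rho> ^ level b * \<bar>x t b\<bar> \<le> B)"

lemma uniformly_rapidI:
  assumes "\<And>t b. t \<in> T \<Longrightarrow> \<not> valid b \<Longrightarrow> x t b = 0"
    and "\<And>\<rho>. 0 < \<rho> \<Longrightarrow> \<exists>B. \<forall>t\<in>T. \<forall>b. \<rho> ^ level b * \<bar>x t b\<bar> \<le> B"
  shows "uniformly_rapid T x"
  using assms by (simp add: uniformly_rapid_def)

lemma uniformly_rapid_support: "uniformly_rapid T x \<Longrightarrow> t \<in> T \<Longrightarrow> \<not> valid b \<Longrightarrow> x t b = 0"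
  by (simp add: uniformly_rapid_def)

lemma uniformly_rapid_bound:
  assumes "uniformly_rapid T x" "0 < \<rho>"
  obtains B where "0 \<le> B" "\<And>t b. t \<in> T \<Longrightarrow> \<rho> ^ level b * \<bar>x t b\<bar> \<le> B"
proof -
  obtain B where "\<And>t b. t \<in> T \<Longrightarrow> \<rho> ^ level b * \<bar>x t b\<bar> \<le> B"
    using assms unfolding uniformly_rapid_def by blast
  then show thesis by (intro that[of "max 0 B"]) (auto simp: le_max_iff_disj)
qed

lemma uniformly_rapid_compose:
  "uniformly_rapid T x \<Longrightarrow> (\<And>s. s \<in> S \<Longrightarrow> \<phi> s \<in> T) \<Longrightarrow> uniformly_rapid S (\<lambda>s. x (\<phi> s))"
  unfolding uniformly_rapid_def by blast

lemma uniformly_rapid_cong: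
  "(\<And>t. t \<in> T \<Longrightarrow> x t = y t) \<Longrightarrow> uniformly_rapid T x \<longleftrightarrow> uniformly_rapid T y"
  unfolding uniformly_rapid_def by simp

lemma uniformly_rapid_reindex:
  assumes x: "uniformly_rapid T x" and "\<And>b. level (\<pi> b) = level b" "\<And>b. valid (\<pi> b) \<longleftrightarrow> valid b"
  shows "uniformly_rapid T (\<lambda>t b. x t (\<pi> b))"
proof (rule uniformly_rapidI)
  fix \<rho> :: real assume "0 < \<rho>"
  obtain B where B: "\<And>t b. t \<in> T \<Longrightarrow> \<rho> ^ level b * \<bar>x t b\<bar> \<le> B"
    by (rule uniformly_rapid_bound[OF x \<open>0 < \<rho>\<close>]) blast
  from B[of _ "\<pi> _"] show "\<exists>B. \<forall>t\<in>T. \<forall>b. \<rho> ^ level b * \<bar>x t (\<pi> b)\<bar> \<le> B"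
    by (auto simp: assms(2))
qed (simp add: uniformly_rapid_support[OF x] assms(3))

lemma uniformly_rapid_finite_support:
  assumes "finite F" "\<And>b. b \<in> F \<Longrightarrow> valid b"
    and outside: "\<And>t b. t \<in> T \<Longrightarrow> b \<notin> F \<Longrightarrow> x t b = 0"
    and bounded: "\<And>b. b \<in> F \<Longrightarrow> bounded ((\<lambda>t. x t b) ` T)"
  shows "uniformly_rapid T x"
proof (rule uniformly_rapidI)
  fix \<rho> :: real assume "0 < \<rho>"
  have "\<forall>b\<in>F. \<exists>K. \<forall>t\<in>T. \<bar>x t b\<bar> \<le> K" using bounded by (simp add: bounded_iff)
  then obtain K where K: "\<And>b t. b \<in> F \<Longrightarrow> t \<in> T \<Longrightarrow> \<bar>x t b\<bar> \<le> K b" by metis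
  have "\<rho> ^ level b * \<bar>x t b\<bar> \<le> (\<Sum>b\<in>F. \<rho> ^ level b * \<bar>K b\<bar>)" if "t \<in> T" for t b
  proof (cases "b \<in> F")
    case True
    have "\<rho> ^ level b * \<bar>x t b\<bar> \<le> \<rho> ^ level b * \<bar>K b\<bar>"
      using K[OF True that] \<open>0 < \<rho>\<close> by (intro mult_left_mono) auto
    also have "\<dots> \<le> (\<Sum>b\<in>F. \<rho> ^ level b * \<bar>K b\<bar>)"
      using True assms(1) \<open>0 < \<rho>\<close> by (intro member_le_sum) auto
    finally show ?thesis .
  qed (use outside[OF that] \<open>0 < \<rho>\<close> in \<open>auto intro: sum_nonneg\<close>)
  then show "\<exists>B. \<forall>t\<in>T. \<forall>b. \<rho> ^ level b * \<bar>x t b\<bar> \<le> B" by blast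
qed (use assms in blast)

lemma uniformly_rapid_integral:
  fixes x :: "'t \<Rightarrow> real \<Rightarrow> 'i \<Rightarrow> real"
  assumes rapid: "uniformly_rapid (SIGMA t:T. {p t..q t}) (\<lambda>(t, \<tau>). x t \<tau>)"
    and cont: "\<And>t b. t \<in> T \<Longrightarrow> continuous_on {p t..q t} (\<lambda>\<tau>. x t \<tau> b)"
    and length: "\<And>t. t \<in> T \<Longrightarrow> p t \<le> q t \<and> q t - p t \<le> L"
  shows "uniformly_rapid T (\<lambda>t b. integral {p t..q t} (\<lambda>\<tau>. x t \<tau> b))"
proof (rule uniformly_rapidI)
  fix t b assume "t \<in> T" "\<not> valid b"
  then have "integral {p t..q t} (\<lambda>\<tau>. x t \<tau> b) = integral {p t..q t} (\<lambda>\<tau>. 0)"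
    using uniformly_rapid_support[OF rapid] by (intro integral_cong) auto
  then show "integral {p t..q t} (\<lambda>\<tau>. x t \<tau> b) = 0" by simp
next
  fix \<rho> :: real assume "0 < \<rho>"
  obtain B where "0 \<le> B" and B: "\<And>z b. z \<in> (SIGMA t:T. {p t..q t}) \<Longrightarrow>
      \<rho> ^ level b * \<bar>(case z of (t, \<tau>) \<Rightarrow> x t \<tau>) b\<bar> \<le> B"
    by (rule uniformly_rapid_bound[OF rapid \<open>0 < \<rho>\<close>]) blast
  have "\<rho> ^ level b * \<bar>integral {p t..q t} (\<lambda>\<tau>. x t \<tau> b)\<bar> \<le> B * L" if "t \<in> T" for t b
  proof -
    have "norm (integral {p t..q t} (\<lambda>\<tau>. x t \<tau> b)) \<le> B / \<rho> ^ level b * (q t - p t)"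
    proof (rule integral_bound[OF _ cont[OF that]])
      show "norm (x t \<tau> b) \<le> B / \<rho> ^ level b" if "\<tau> \<in> {p t..q t}" for \<tau>
        using B[of "(t, \<tau>)" b] \<open>t \<in> T\<close> that \<open>0 < \<rho>\<close> by (simp add: pos_le_divide_eq mult.commute)
    qed (use length[OF that] in blast)
    then have "\<rho> ^ level b * \<bar>integral {p t..q t} (\<lambda>\<tau>. x t \<tau> b)\<bar> \<le> B * (q t - p t)"
      using \<open>0 < \<rho>\<close> by (simp add: field_simps)
    also have "\<dots> \<le> B * L" using \<open>0 \<le> B\<close> length[OF that] by (intro mult_left_mono) auto
    finally show ?thesis .
  qed
  then show "\<exists>B. \<forall>t\<in>T. \<forall>b. \<rho> ^ level b * \<bar>integral {p t..q t} (\<lambda>\<tau>. x t \<tau> b)\<bar> \<le> B" by blast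
qed

lemma sum_level_le:
  assumes "0 < \<rho>" and bound: "\<And>b. (2 * real growth * \<rho>) ^ level b * \<bar>x b\<bar> \<le> B"
  shows "\<rho> ^ n * (\<Sum>b | valid b \<and> level b = n. \<bar>x b\<bar>) \<le> B * (1/2) ^ n"
proof -
  let ?K = "B / (2 * real growth * \<rho>) ^ n"
  have pos: "0 < 2 * real growth * \<rho>" using growth_pos \<open>0 < \<rho>\<close> by simp
  have "0 \<le> (2 * real growth * \<rho>) ^ level b * \<bar>x b\<bar>" for b using pos by simp
  then have "0 \<le> B" using bound order_trans by blast
  have "(\<Sum>b | valid b \<and> level b = n. \<bar>x b\<bar>) \<le> card {b. valid b \<and> level b = n} * ?K"
  proof (rule sum_bounded_above)
    fix b assume "b \<in> {b. valid b \<and> level b = n}"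
    then show "\<bar>x b\<bar> \<le> ?K" using bound[of b] pos by (simp add: pos_le_divide_eq mult.commute)
  qed
  also have "\<dots> \<le> real growth ^ n * ?K"
    using card_level_le[of n] \<open>0 \<le> B\<close> pos
    by (intro mult_right_mono divide_nonneg_pos) (simp_all flip: of_nat_power)
  finally have "\<rho> ^ n * (\<Sum>b | valid b \<and> level b = n. \<bar>x b\<bar>) \<le> \<rho> ^ n * (real growth ^ n * ?K)"
    using \<open>0 < \<rho>\<close> by (intro mult_left_mono) simp_all
  also have "\<dots> = B * (1/2) ^ n"
    using growth_pos \<open>0 < \<rho>\<close> by (simp add: power_mult_distrib power_one_over)
  finally show ?thesis .
qed

end

section \<open>Entire elements and continuous functionals\<close>

lemma limitin_topology_generated_by:
  assumes "x \<in> \<Union>\<B>" and sub: "\<And>U. U \<in> \<B> \<Longrightarrow> x \<in> U \<Longrightarrow> \<forall>\<^sub>F n in F. X n \<in> U"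
  shows "limitin (topology_generated_by \<B>) X x F"
  unfolding limitin_def
proof (intro conjI allI impI)
  show "x \<in> topspace (topology_generated_by \<B>)"
    using assms(1) by (simp add: topology_generated_by_topspace)
  fix U assume "openin (topology_generated_by \<B>) U \<and> x \<in> U"
  then have "generate_topology_on \<B> U" "x \<in> U" by (auto simp: openin_topology_generated_by_iff)
  then show "\<forall>\<^sub>F n in F. X n \<in> U"
  proof induction
    case (Int U V)
    then show ?case by (auto intro: eventually_conj)
  next
    case (UN K)
    then obtain U where "U \<in> K" "x \<in> U" by blast
    with UN.IH have "\<forall>\<^sub>F n in F. X n \<in> U" by blast
    then show ?case by (rule eventually_mono) (use \<open>U \<in> K\<close> in blast)
  qed (use sub in auto)
qed

locale graded_seminorms = graded_index valid level growth
  for valid :: "'i \<Rightarrow> bool" and level growth +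
  fixes N :: "nat \<Rightarrow> ('i \<Rightarrow> real) \<Rightarrow> real"
  assumes N_nonneg: "0 \<le> N k x"
    and N_triangle: "N k (\<lambda>b. x b + y b) \<le> N k x + N k y"
    and N_uminus: "N k (\<lambda>b. - x b) = N k x"
    and N_le_sum_abs: "N k x \<le> (\<Sum>b | valid b \<and> level b = k. \<bar>x b\<bar>)"
begin

definition entire :: "('i \<Rightarrow> real) set" where
  "entire = {a. (\<forall>b. \<not> valid b \<longrightarrow> a b = 0) \<and> (\<forall>\<rho>>0. summable (\<lambda>k. \<rho> ^ k * N k a))}"

definition seminorm :: "real \<Rightarrow> ('i \<Rightarrow> real) \<Rightarrow> real" where
  "seminorm \<rho> a = (\<Sum>k. \<rho> ^ k * N k a)"

definition entire_topology :: "('i \<Rightarrow> real) topology" where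
  "entire_topology = topology_generated_by
     {{b \<in> entire. seminorm \<rho> (\<lambda>i. b i - a i) < r} | a \<rho> r. a \<in> entire \<and> \<rho> > 0 \<and> r > 0}"

lemma N_diff_triangle: "N k (\<lambda>b. x b - z b) \<le> N k (\<lambda>b. x b - y b) + N k (\<lambda>b. y b - z b)"
  using N_triangle[of k "\<lambda>b. x b - y b" "\<lambda>b. y b - z b"] by simp

lemma N_zero: "N k (\<lambda>b. 0) = 0"
  using N_le_sum_abs[of k "\<lambda>b. 0"] N_nonneg[of k "\<lambda>b. 0"] by simp

lemma summable_diff:
  assumes "x \<in> entire" "y \<in> entire" "\<rho> > 0"
  shows "summable (\<lambda>k. \<rho> ^ k * N k (\<lambda>b. x b - y b))"
proof (rule summable_comparison_test')
  show "summable (\<lambda>k. \<rho> ^ k * N k x + \<rho> ^ k * N k y)"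
    using assms by (intro summable_add) (auto simp: entire_def)
  have "N k (\<lambda>b. x b - y b) \<le> N k x + N k y" for k
    using N_triangle[of k x "\<lambda>b. - y b"] by (simp add: N_uminus)
  then show "norm (\<rho> ^ k * N k (\<lambda>b. x b - y b)) \<le> \<rho> ^ k * N k x + \<rho> ^ k * N k y" for k
    using assms(3) by (simp add: N_nonneg mult_left_mono flip: distrib_left)
qed

lemma seminorm_diff_triangle:
  assumes "x \<in> entire" "y \<in> entire" "z \<in> entire" "\<rho> > 0"
  shows "seminorm \<rho> (\<lambda>b. x b - z b) \<le> seminorm \<rho> (\<lambda>b. x b - y b) + seminorm \<rho> (\<lambda>b. y b - z b)"
  using assms unfolding seminorm_def
    suminf_add[OF summable_diff[OF assms(1,2,4)] summable_diff[OF assms(2,3,4)]]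
  by (intro suminf_le summable_add summable_diff)
    (simp_all add: N_diff_triangle mult_left_mono flip: distrib_left)

lemma limitin_entire_topology:
  assumes "\<And>n. X n \<in> entire" "x \<in> entire"
    and lim: "\<And>\<rho>. \<rho> > 0 \<Longrightarrow> ((\<lambda>n. seminorm \<rho> (\<lambda>b. X n b - x b)) \<longlongrightarrow> 0) F"
  shows "limitin entire_topology X x F"
  unfolding entire_topology_def
proof (rule limitin_topology_generated_by)
  have "x \<in> {b \<in> entire. seminorm 1 (\<lambda>i. b i - x i) < 1}"
    using assms(2) by (simp add: seminorm_def N_zero)
  then show "x \<in> \<Union>{{b \<in> entire. seminorm \<rho> (\<lambda>i. b i - a i) < r} | a \<rho> r. a \<in> entire \<and> \<rho> > 0 \<and> r > 0}"
    using assms(2) zero_less_one by blast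
next
  fix U assume "x \<in> U"
    and "U \<in> {{b \<in> entire. seminorm \<rho> (\<lambda>i. b i - a i) < r} | a \<rho> r. a \<in> entire \<and> \<rho> > 0 \<and> r > 0}"
  then obtain a \<rho> r where U: "U = {b \<in> entire. seminorm \<rho> (\<lambda>i. b i - a i) < r}"
      and "a \<in> entire" "\<rho> > 0" "seminorm \<rho> (\<lambda>i. x i - a i) < r" by blast
  then have "\<forall>\<^sub>F n in F. seminorm \<rho> (\<lambda>b. X n b - x b) < r - seminorm \<rho> (\<lambda>i. x i - a i)"
    by (intro order_tendstoD(2)[OF lim]) auto
  then show "\<forall>\<^sub>F n in F. X n \<in> U"
  proof eventually_elim
    case (elim n)
    have "seminorm \<rho> (\<lambda>i. X n i - a i) < r"
      using seminorm_diff_triangle[OF assms(1)[of n] assms(2) \<open>a \<in> entire\<close> \<open>\<rho> > 0\<close>] elim by linarith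
    then show ?case by (simp add: U assms(1))
  qed
qed

lemma
  assumes "0 < \<rho>" and bound: "\<And>b. (2 * real growth * \<rho>) ^ level b * \<bar>x b\<bar> \<le> B"
  shows summable_seminorm: "summable (\<lambda>n. \<rho> ^ n * N n x)"
    and seminorm_nonneg: "0 \<le> seminorm \<rho> x"
    and seminorm_le: "seminorm \<rho> x \<le> 2 * B"
proof -
  have le: "\<rho> ^ n * N n x \<le> B * (1/2) ^ n" for n
  proof -
    have "\<rho> ^ n * N n x \<le> \<rho> ^ n * (\<Sum>b | valid b \<and> level b = n. \<bar>x b\<bar>)"
      using \<open>0 < \<rho>\<close> by (intro mult_left_mono N_le_sum_abs) simp
    also have "\<dots> \<le> B * (1/2) ^ n" by (rule sum_level_le[OF assms])
    finally show ?thesis .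
  qed
  have geometric: "(\<lambda>n. B * (1/2) ^ n) sums (2 * B)"
    using sums_mult[OF geometric_sums[of "1/2 :: real"], of B] by (simp add: mult.commute)
  have nonneg: "0 \<le> \<rho> ^ n * N n x" for n using \<open>0 < \<rho>\<close> by (simp add: N_nonneg)
  show summable: "summable (\<lambda>n. \<rho> ^ n * N n x)"
    by (rule summable_comparison_test'[OF sums_summable[OF geometric]]) (use le nonneg in simp)
  show "0 \<le> seminorm \<rho> x" unfolding seminorm_def by (intro suminf_nonneg summable nonneg)
  show "seminorm \<rho> x \<le> 2 * B"
    unfolding seminorm_def sums_unique[OF geometric]
    by (intro suminf_le le summable sums_summable[OF geometric])
qed

lemma uniformly_rapid_entire:
  assumes x: "uniformly_rapid T x" and "t \<in> T"
  shows "x t \<in> entire"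
proof -
  have "summable (\<lambda>k. \<rho> ^ k * N k (x t))" if "\<rho> > 0" for \<rho>
  proof -
    have pos: "0 < 2 * real growth * \<rho>" using that growth_pos by simp
    obtain B where "\<And>t b. t \<in> T \<Longrightarrow> (2 * real growth * \<rho>) ^ level b * \<bar>x t b\<bar> \<le> B"
      by (rule uniformly_rapid_bound[OF x pos]) blast
    from summable_seminorm[OF that this[OF \<open>t \<in> T\<close>]] show ?thesis .
  qed
  then show ?thesis using uniformly_rapid_support[OF assms] by (simp add: entire_def)
qed

lemma uniformly_rapid_truncate:
  assumes x: "uniformly_rapid T x"
  shows "uniformly_rapid T (\<lambda>t b. if P b then x t b else 0)"
proof (rule uniformly_rapidI)
  fix \<rho> :: real assume "0 < \<rho>"
  then obtain B where "0 \<le> B" "\<And>t b. t \<in> T \<Longrightarrow> \<rho> ^ level b * \<bar>x t b\<bar> \<le> B"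
    using uniformly_rapid_bound[OF x] by blast
  then show "\<exists>B. \<forall>t\<in>T. \<forall>b. \<rho> ^ level b * \<bar>if P b then x t b else 0\<bar> \<le> B"
    by (intro exI[of _ B]) auto
qed (simp add: uniformly_rapid_support[OF x])

lemma truncation_tendsto:
  assumes x: "uniformly_rapid T x" and "t \<in> T"
  shows "limitin entire_topology (\<lambda>m b. if level b < m then x t b else 0) (x t) sequentially"
proof (rule limitin_entire_topology)
  let ?tr = "\<lambda>m b. if level b < m then x t b else 0"
  have tr: "?tr m \<in> entire" for m
    using uniformly_rapid_entire[OF uniformly_rapid_truncate[OF x] \<open>t \<in> T\<close>] .
  show "?tr m \<in> entire" "x t \<in> entire" for m
    using tr uniformly_rapid_entire[OF assms] by blast+
  fix \<rho> :: real assume "\<rho> > 0"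
  then have pos: "0 < 4 * real growth * \<rho>" using growth_pos by simp
  obtain B where B: "0 \<le> B" "\<And>t b. t \<in> T \<Longrightarrow> (4 * real growth * \<rho>) ^ level b * \<bar>x t b\<bar> \<le> B"
    by (rule uniformly_rapid_bound[OF x pos]) blast
  have tail: "(2 * real growth * \<rho>) ^ level b * \<bar>?tr m b - x t b\<bar> \<le> B * (1/2) ^ m" for m b
  proof (cases "level b < m")
    case False
    have "(2 * real growth * \<rho>) ^ level b = (4 * real growth * \<rho>) ^ level b * (1/2) ^ level b"
      by (subst power_mult_distrib[symmetric]) (simp add: field_simps)
    then have "(2 * real growth * \<rho>) ^ level b * \<bar>x t b\<bar>
        = (4 * real growth * \<rho>) ^ level b * \<bar>x t b\<bar> * (1/2) ^ level b"
      by simp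
    also have "\<dots> \<le> B * (1/2) ^ m"
      using False B \<open>t \<in> T\<close> by (intro mult_mono power_decreasing) auto
    finally show ?thesis using False by simp
  qed (use B(1) in simp)
  have "(\<lambda>m. 2 * (B * (1/2) ^ m)) \<longlonglongrightarrow> 2 * (B * 0)"
    by (intro tendsto_mult tendsto_const LIMSEQ_power_zero) simp
  then have vanishes: "(\<lambda>m. 2 * (B * (1/2) ^ m)) \<longlonglongrightarrow> 0" by simp
  show "(\<lambda>m. seminorm \<rho> (\<lambda>b. ?tr m b - x t b)) \<longlonglongrightarrow> 0"
    by (rule real_tendsto_sandwich[OF _ _ tendsto_const vanishes])
      (use seminorm_le[OF \<open>\<rho> > 0\<close> tail] seminorm_nonneg[OF \<open>\<rho> > 0\<close> tail] in auto)
qed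

lemma finite_support_entire:
  assumes "finite I" "\<And>i. i \<in> I \<Longrightarrow> valid i"
  shows "(\<lambda>b. if b \<in> I then x b else 0) \<in> entire"
proof -
  have "uniformly_rapid {x} (\<lambda>x b. if b \<in> I then x b else 0)"
    using assms by (intro uniformly_rapid_finite_support[of I]) auto
  then show ?thesis by (rule uniformly_rapid_entire) simp
qed

lemma basis_vec_entire: "valid b \<Longrightarrow> basis_vec b \<in> entire"
  using finite_support_entire[of "{b}" "\<lambda>_. 1"] by (simp add: basis_vec_def[abs_def])

end

locale graded_functional = graded_seminorms valid level growth N
  for valid :: "'i \<Rightarrow> bool" and level growth N +
  fixes f :: "('i \<Rightarrow> real) \<Rightarrow> 'c::banach" and A K :: real
  assumes linear: "x \<in> entire \<Longrightarrow> y \<in> entire \<Longrightarrow> f (\<lambda>b. c * x b + y b) = c *\<^sub>R f x + f y"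
    and continuous: "continuous_map entire_topology euclidean f"
    and basis_bound: "valid b \<Longrightarrow> norm (f (basis_vec b)) \<le> A * K ^ level b"
    and A_nonneg: "0 \<le> A" and K_pos: "0 < K"
begin

definition level_value :: "nat \<Rightarrow> ('i \<Rightarrow> real) \<Rightarrow> 'c" where
  "level_value n x = (\<Sum>b | valid b \<and> level b = n. x b *\<^sub>R f (basis_vec b))"

lemma f_zero: "f (\<lambda>b. 0) = 0"
  using linear[of "\<lambda>b. 0" "\<lambda>b. 0" 1] finite_support_entire[of "{}"] by simp

lemma f_finite_support:
  assumes "finite I" "\<And>i. i \<in> I \<Longrightarrow> valid i"
  shows "f (\<lambda>b. if b \<in> I then x b else 0) = (\<Sum>i\<in>I. x i *\<^sub>R f (basis_vec i))"
  using assms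
proof (induction I)
  case (insert i I)
  have "(\<lambda>b. if b \<in> insert i I then x b else 0)
      = (\<lambda>b. x i * basis_vec i b + (if b \<in> I then x b else 0))"
    using insert.hyps by (auto simp: basis_vec_def fun_eq_iff)
  then have "f (\<lambda>b. if b \<in> insert i I then x b else 0)
      = x i *\<^sub>R f (basis_vec i) + f (\<lambda>b. if b \<in> I then x b else 0)"
    using insert by (simp add: linear basis_vec_entire finite_support_entire)
  then show ?case using insert by simp
qed (simp add: f_zero)

lemma f_truncation:
  assumes "\<And>b. \<not> valid b \<Longrightarrow> x b = 0"
  shows "f (\<lambda>b. if level b < m then x b else 0) = (\<Sum>n<m. level_value n x)"
proof -
  let ?I = "\<Union>n<m. {b. valid b \<and> level b = n}"
  have "(\<lambda>b. if level b < m then x b else 0) = (\<lambda>b. if b \<in> ?I then x b else 0)"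
    using assms by (auto simp: fun_eq_iff)
  then have "f (\<lambda>b. if level b < m then x b else 0) = (\<Sum>b\<in>?I. x b *\<^sub>R f (basis_vec b))"
    using finite_level by (simp only:) (intro f_finite_support, auto)
  also have "\<dots> = (\<Sum>n<m. level_value n x)"
    unfolding level_value_def using finite_level by (intro sum.UNION_disjoint) auto
  finally show ?thesis .
qed

lemma level_value_sums:
  assumes "uniformly_rapid T x" "t \<in> T"
  shows "(\<lambda>n. level_value n (x t)) sums f (x t)"
  using continuous_map_limit[OF continuous truncation_tendsto[OF assms]]
    uniformly_rapid_support[OF assms]
  by (simp add: sums_def o_def f_truncation)

lemma norm_level_value_le:
  assumes "\<And>b. (2 * real growth * K) ^ level b * \<bar>x b\<bar> \<le> B"
  shows "norm (level_value n x) \<le> A * B * (1/2) ^ n"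
proof -
  have "norm (level_value n x) \<le> (\<Sum>b | valid b \<and> level b = n. \<bar>x b\<bar> * (A * K ^ n))"
    unfolding level_value_def by (rule sum_norm_le) (use basis_bound in \<open>auto simp: mult_left_mono\<close>)
  also have "\<dots> = A * (K ^ n * (\<Sum>b | valid b \<and> level b = n. \<bar>x b\<bar>))"
    by (simp add: sum_distrib_left mult_ac)
  also have "\<dots> \<le> A * (B * (1/2) ^ n)"
    by (intro mult_left_mono sum_level_le[OF K_pos assms] A_nonneg)
  finally show ?thesis by simp
qed

lemma uniform_level_bound:
  assumes "uniformly_rapid T x"
  obtains B where "\<And>t n. t \<in> T \<Longrightarrow> norm (level_value n (x t)) \<le> B * (1/2) ^ n"
proof -
  have pos: "0 < 2 * real growth * K" using K_pos growth_pos by simp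
  obtain B where "\<And>t b. t \<in> T \<Longrightarrow> (2 * real growth * K) ^ level b * \<bar>x t b\<bar> \<le> B"
    by (rule uniformly_rapid_bound[OF assms pos]) blast
  then have "norm (level_value n (x t)) \<le> A * B * (1/2) ^ n" if "t \<in> T" for t n
    using that by (intro norm_level_value_le)
  then show thesis by (rule that)
qed

lemma uniform_limit_level_values:
  assumes "uniformly_rapid T x"
  shows "uniform_limit T (\<lambda>m t. \<Sum>n<m. level_value n (x t)) (\<lambda>t. f (x t)) sequentially"
proof -
  obtain B where B: "\<And>t n. t \<in> T \<Longrightarrow> norm (level_value n (x t)) \<le> B * (1/2) ^ n"
    by (rule uniform_level_bound[OF assms]) blast
  have "uniform_limit T (\<lambda>m t. \<Sum>n<m. level_value n (x t)) (\<lambda>t. \<Sum>n. level_value n (x t)) sequentially"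
    by (rule Weierstrass_m_test[OF B]) (auto intro!: summable_mult summable_geometric)
  then show ?thesis
    by (rule uniform_limit_cong'[THEN iffD1, rotated -1])
      (simp_all add: sums_unique[OF level_value_sums[OF assms], symmetric])
qed

lemma bounded_image:
  assumes "uniformly_rapid T x"
  shows "bounded ((\<lambda>t. f (x t)) ` T)"
proof -
  obtain B where B: "\<And>t n. t \<in> T \<Longrightarrow> norm (level_value n (x t)) \<le> B * (1/2) ^ n"
    by (rule uniform_level_bound[OF assms]) blast
  have "norm (f (x t)) \<le> (\<Sum>n. B * (1/2) ^ n)" if "t \<in> T" for t
    unfolding sums_unique[OF level_value_sums[OF assms that]]
    by (rule norm_suminf_le[OF B[OF that]]) (auto intro!: summable_mult summable_geometric)
  then show ?thesis unfolding bounded_iff by blast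
qed

lemma has_integral_image:
  fixes x :: "real \<Rightarrow> 'i \<Rightarrow> real"
  assumes "p \<le> q" and x: "uniformly_rapid {p..q} x"
    and cont: "\<And>b. continuous_on {p..q} (\<lambda>t. x t b)"
  shows "((\<lambda>t. f (x t)) has_integral f (\<lambda>b. integral {p..q} (\<lambda>t. x t b))) {p..q}"
proof -
  let ?I = "\<lambda>b. integral {p..q} (\<lambda>t. x t b)"
  have "uniformly_rapid {()} (\<lambda>_. ?I)"
    using x cont \<open>p \<le> q\<close>
    by (intro uniformly_rapid_integral[of _ "\<lambda>_. p" "\<lambda>_. q", where L = "q - p"])
      (auto intro: uniformly_rapid_compose simp: case_prod_unfold)
  from level_value_sums[OF this] have I: "(\<lambda>n. level_value n ?I) sums f ?I" by simp
  have level: "((\<lambda>t. level_value n (x t)) has_integral level_value n ?I) {p..q}" for n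
    unfolding level_value_def using finite_level
    by (intro has_integral_sum has_integral_scaleR_left integrable_integral
      integrable_continuous_interval cont)
  obtain J j where J: "\<And>m. ((\<lambda>t. \<Sum>n<m. level_value n (x t)) has_integral J m) {p..q}"
      and j: "((\<lambda>t. f (x t)) has_integral j) {p..q}" and lim: "J \<longlonglongrightarrow> j"
    by (rule uniform_limit_integral[OF uniform_limit_level_values[OF x]])
      (auto simp: level_value_def intro!: continuous_intros cont)
  have "J m = (\<Sum>n<m. level_value n ?I)" for m
    by (rule has_integral_unique[OF J has_integral_sum[OF finite_lessThan level]])
  then have "J = (\<lambda>m. \<Sum>n<m. level_value n ?I)" by blast
  then have "J \<longlonglongrightarrow> f ?I" using I by (simp add: sums_def)
  then show ?thesis using j lim LIMSEQ_unique by blast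
qed

lemma has_vector_derivative_image:
  fixes x x' :: "real \<Rightarrow> 'i \<Rightarrow> real"
  assumes "convex S" "t \<in> S" and x: "uniformly_rapid S x" and x': "uniformly_rapid S x'"
    and deriv: "\<And>t b. t \<in> S \<Longrightarrow> ((\<lambda>t. x t b) has_real_derivative x' t b) (at t within S)"
  shows "((\<lambda>t. f (x t)) has_vector_derivative f (x' t)) (at t within S)"
proof -
  have "\<exists>g. \<forall>t\<in>S. (\<lambda>n. level_value n (x t)) sums g t \<and>
      (g has_derivative (\<lambda>h. h *\<^sub>R f (x' t))) (at t within S)"
  proof (rule has_derivative_series[OF \<open>convex S\<close> _ _ \<open>t \<in> S\<close>])
    show "(\<lambda>n. level_value n (x t)) sums f (x t)" by (rule level_value_sums[OF x \<open>t \<in> S\<close>])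
    show "((\<lambda>t. level_value n (x t)) has_derivative (\<lambda>h. h *\<^sub>R level_value n (x' t)))
        (at t within S)"
      if "t \<in> S" for n t
      unfolding level_value_def has_vector_derivative_def[symmetric] using deriv[OF that]
      by (intro has_vector_derivative_sum) (auto intro!: derivative_eq_intros)
    fix e :: real assume "e > 0"
    from uniform_limitD[OF uniform_limit_level_values[OF x'] this]
    show "\<forall>\<^sub>F m in sequentially. \<forall>t\<in>S. \<forall>h.
        norm ((\<Sum>n<m. h *\<^sub>R level_value n (x' t)) - h *\<^sub>R f (x' t)) \<le> e * norm h"
    proof eventually_elim
      case (elim m)
      have "norm ((\<Sum>n<m. h *\<^sub>R level_value n (x' t)) - h *\<^sub>R f (x' t))
          = norm h * dist (\<Sum>n<m. level_value n (x' t)) (f (x' t))" for t h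
        by (simp add: dist_norm flip: scaleR_sum_right scaleR_diff_right)
      then show ?case using elim by (auto simp: mult.commute[of e] intro!: mult_left_mono)
    qed
  qed
  then obtain g where g: "\<And>t. t \<in> S \<Longrightarrow> (\<lambda>n. level_value n (x t)) sums g t"
      "\<And>t. t \<in> S \<Longrightarrow> (g has_derivative (\<lambda>h. h *\<^sub>R f (x' t))) (at t within S)" by blast
  have "f (x t) = g t" if "t \<in> S" for t
    by (rule sums_unique2[OF level_value_sums[OF x that] g(1)[OF that]])
  then show ?thesis
    unfolding has_vector_derivative_def
    by (rule has_derivative_transform[OF \<open>t \<in> S\<close> _ g(2)[OF \<open>t \<in> S\<close>]])
qed

end

section \<open>The tensor algebra and the free bimodule\<close>

lemma finite_valid0_level: "finite {w. valid0 d w \<and> length w = n}"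
  using finite_lists_length_eq[of "{..<d}" n] by (simp add: valid0_def)

lemma card_valid0_level: "card {w. valid0 d w \<and> length w = n} = d ^ n"
  using card_lists_length_eq[of "{..<d}" n] by (simp add: valid0_def)

lemma norm0_eq_L2_set: "norm0 d k a = L2_set a {w. valid0 d w \<and> length w = k}"
  by (simp add: norm0_def L2_set_def words_def conj_commute)

interpretation T0: graded_seminorms "valid0 d" length "Suc d" "norm0 d" for d
proof
  fix n k :: nat and x y :: t0
  show "finite {b. valid0 d b \<and> length b = n}" by (rule finite_valid0_level)
  show "card {b. valid0 d b \<and> length b = n} \<le> Suc d ^ n"
    by (simp add: card_valid0_level power_mono)
  show "0 \<le> norm0 d k x" by (simp add: norm0_def sum_nonneg)
  show "norm0 d k (\<lambda>b. x b + y b) \<le> norm0 d k x + norm0 d k y"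
    unfolding norm0_eq_L2_set by (rule L2_set_triangle_ineq)
  show "norm0 d k (\<lambda>b. - x b) = norm0 d k x" by (simp add: norm0_def)
  show "norm0 d k x \<le> (\<Sum>b | valid0 d b \<and> length b = k. \<bar>x b\<bar>)"
    unfolding norm0_eq_L2_set by (rule L2_set_le_sum_abs)
qed simp

lemma valid1_iff: "valid1 d (u, (i, j), v) \<longleftrightarrow> valid0 d u \<and> valid0 d v \<and> i < j \<and> j < d"
  by (simp add: valid1_def valid0_def)

lemma
  shows finite_valid1_level: "finite {b. valid1 d b \<and> level1 b = n}"
    and card_valid1_level_le: "card {b. valid1 d b \<and> level1 b = n} \<le> Suc n * d ^ n"
proof -
  let ?B = "{b. valid1 d b \<and> level1 b = n}" and ?W = "{..n} \<times> {w. valid0 d w \<and> length w = n}"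
  define glue :: "tb \<Rightarrow> nat \<times> nat list" where "glue = (\<lambda>(u, (i, j), v). (length u, u @ [i, j] @ v))"
  have "inj glue" by (rule injI) (clarsimp simp: glue_def)
  then have inj: "inj_on glue ?B" by (rule inj_on_subset) simp
  have sub: "glue ` ?B \<subseteq> ?W" by (auto simp: glue_def level1_def valid1_iff valid0_def)
  have fin: "finite ?W" by (simp add: finite_valid0_level)
  show "finite ?B" by (rule finite_imageD[OF finite_subset[OF sub fin] inj])
  have "card ?B \<le> card ?W" by (rule card_inj_on_le[OF inj sub fin])
  then show "card ?B \<le> Suc n * d ^ n" by (simp add: card_cartesian_product card_valid0_level)
qed

lemma Pfn_zero: "(\<lambda>b. 0) \<in> Pfn d n"
  by (simp add: Pfn_def Pf_zero)

lemma Pfn_add: "P \<in> Pfn d n \<Longrightarrow> Q \<in> Pfn d n \<Longrightarrow> (\<lambda>b. P b + Q b) \<in> Pfn d n"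
  by (simp add: Pfn_def Pf_add)

lemma Pfn_uminus: "P \<in> Pfn d n \<Longrightarrow> (\<lambda>b. - P b) \<in> Pfn d n"
  using Pf_scale[of P d "-1"] by (simp add: Pfn_def)

lemma norm1_le:
  assumes "P \<in> Pfn d n"
  shows "norm1 d n E \<le> L2_set (\<lambda>b. E b - P b) (basis1 d n)"
  unfolding norm1_def L2_set_def
  by (rule cInf_lower) (use assms in \<open>auto intro!: bdd_belowI[of _ 0] sum_nonneg\<close>)

lemma norm1_greatest:
  assumes "\<And>P. P \<in> Pfn d n \<Longrightarrow> c \<le> L2_set (\<lambda>b. E b - P b) (basis1 d n)"
  shows "c \<le> norm1 d n E"
  unfolding norm1_def
  by (rule cInf_greatest) (use assms Pfn_zero in \<open>auto simp: L2_set_def\<close>)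

lemma norm1_uminus_le: "norm1 d n (\<lambda>b. - E b) \<le> norm1 d n E"
proof (rule norm1_greatest)
  fix P assume "P \<in> Pfn d n"
  from norm1_le[OF Pfn_uminus[OF this], of "\<lambda>b. - E b"]
  have "norm1 d n (\<lambda>b. - E b) \<le> L2_set (\<lambda>b. - (E b - P b)) (basis1 d n)" by simp
  then show "norm1 d n (\<lambda>b. - E b) \<le> L2_set (\<lambda>b. E b - P b) (basis1 d n)"
    by (simp only: L2_set_def power2_minus)
qed

lemma norm1_triangle: "norm1 d n (\<lambda>b. E b + F b) \<le> norm1 d n E + norm1 d n F"
proof -
  have "norm1 d n (\<lambda>b. E b + F b) \<le> L2_set (\<lambda>b. E b - P b) (basis1 d n)
      + L2_set (\<lambda>b. F b - Q b) (basis1 d n)"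
    if "P \<in> Pfn d n" "Q \<in> Pfn d n" for P Q
  proof -
    have "norm1 d n (\<lambda>b. E b + F b) \<le> L2_set (\<lambda>b. (E b - P b) + (F b - Q b)) (basis1 d n)"
      using norm1_le[OF Pfn_add[OF that], of "\<lambda>b. E b + F b"] by (simp add: algebra_simps)
    also have "\<dots> \<le> L2_set (\<lambda>b. E b - P b) (basis1 d n) + L2_set (\<lambda>b. F b - Q b) (basis1 d n)"
      by (rule L2_set_triangle_ineq)
    finally show ?thesis .
  qed
  then have "norm1 d n (\<lambda>b. E b + F b) - L2_set (\<lambda>b. E b - P b) (basis1 d n) \<le> norm1 d n F"
    if "P \<in> Pfn d n" for P
    using that by (intro norm1_greatest) (auto simp: algebra_simps)
  then have "norm1 d n (\<lambda>b. E b + F b) - norm1 d n F \<le> norm1 d n E"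
    by (intro norm1_greatest) (auto simp: algebra_simps)
  then show ?thesis by simp
qed

interpretation T1: graded_seminorms "valid1 d" level1 "2 * Suc d" "norm1 d" for d
proof
  fix n k :: nat and x y :: t1
  show "finite {b. valid1 d b \<and> level1 b = n}" by (rule finite_valid1_level)
  have "Suc n * d ^ n \<le> 2 ^ n * Suc d ^ n"
    by (intro mult_mono power_mono) (auto intro: Suc_leI less_exp)
  then show "card {b. valid1 d b \<and> level1 b = n} \<le> (2 * Suc d) ^ n"
    using card_valid1_level_le[of d n] unfolding power_mult_distrib by linarith
  show "0 \<le> norm1 d k x" by (rule norm1_greatest) (simp add: L2_set_nonneg)
  show "norm1 d k (\<lambda>b. x b + y b) \<le> norm1 d k x + norm1 d k y" by (rule norm1_triangle)
  show "norm1 d k (\<lambda>b. - x b) = norm1 d k x"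
    using norm1_uminus_le[of d k x] norm1_uminus_le[of d k "\<lambda>b. - x b"] by simp
  show "norm1 d k x \<le> (\<Sum>b | valid1 d b \<and> level1 b = k. \<bar>x b\<bar>)"
    using norm1_le[OF Pfn_zero, of d k x] L2_set_le_sum_abs[of x "basis1 d k"]
    by (simp add: basis1_def)
qed simp

lemma E0_eq_entire: "E0 d = T0.entire d"
  by (simp add: E0_def T0.entire_def)

lemma E1_eq_entire: "E1 d = T1.entire d"
  by (simp add: E1_def T1.entire_def)

lemma top0_eq_entire_topology: "top0 d = T0.entire_topology d"
  by (simp add: top0_def T0.entire_topology_def T0.seminorm_def sn0_def E0_eq_entire)

lemma top1_eq_entire_topology: "top1 d = T1.entire_topology d"
  by (simp add: top1_def T1.entire_topology_def T1.seminorm_def sn1_def E1_eq_entire)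

subsection \<open>Algebra of the products\<close>

lemma mul0_Nil: "mul0 a b [] = a [] * b []"
  by (simp add: mul0_def)

lemma mul0_Cons: "mul0 a b (i # w) = a [] * b (i # w) + mul0 (\<lambda>v. a (i # v)) b w"
  unfolding mul0_def length_Cons sum.atMost_Suc_shift by simp

lemma mul0_add_left: "mul0 (\<lambda>v. a v + b v) c w = mul0 a c w + mul0 b c w"
  by (simp add: mul0_def distrib_right sum.distrib)

lemma mul0_scale_left: "mul0 (\<lambda>v. k * a v) c w = k * mul0 a c w"
  by (simp add: mul0_def sum_distrib_left mult.assoc)

lemma mul0_scale_right: "mul0 a (\<lambda>v. k * b v) w = k * mul0 a b w"
  by (simp add: mul0_def sum_distrib_left mult.left_commute)

lemma mul0_uminus_left: "mul0 (\<lambda>v. - a v) b w = - mul0 a b w"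
  by (simp add: mul0_def sum_negf)

lemma mul0_uminus_right: "mul0 a (\<lambda>v. - b v) w = - mul0 a b w"
  by (simp add: mul0_def sum_negf)

lemma mul0_assoc: "mul0 (mul0 a b) c = mul0 a (mul0 b c)"
proof
  fix w show "mul0 (mul0 a b) c w = mul0 a (mul0 b c) w"
  proof (induction w arbitrary: a)
    case (Cons i w)
    have "(\<lambda>v. mul0 a b (i # v)) = (\<lambda>v. a [] * b (i # v) + mul0 (\<lambda>v. a (i # v)) b v)"
      by (simp add: mul0_Cons)
    then have "mul0 (mul0 a b) c (i # w)
        = a [] * b [] * c (i # w)
          + (a [] * mul0 (\<lambda>v. b (i # v)) c w + mul0 (mul0 (\<lambda>v. a (i # v)) b) c w)"
      by (simp only: mul0_Cons[of "mul0 a b"] mul0_add_left mul0_scale_left mul0_Nil)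
    also have "\<dots> = mul0 a (mul0 b c) (i # w)"
      by (simp add: Cons.IH mul0_Cons distrib_left)
    finally show ?case .
  qed (simp add: mul0_Nil)
qed

lemma mul0_one_left: "mul0 one0 a = a"
proof
  fix w show "mul0 one0 a w = a w"
  proof (cases w)
    case (Cons i v)
    have "mul0 (\<lambda>v. one0 (i # v)) a v = 0" by (simp add: mul0_def one0_def)
    then show ?thesis by (simp add: Cons mul0_Cons one0_def)
  qed (simp add: mul0_Nil one0_def)
qed

lemma mul0_one_right: "mul0 a one0 = a"
proof
  fix w show "mul0 a one0 w = a w"
    by (induction w arbitrary: a) (simp_all add: mul0_Nil mul0_Cons, simp_all add: one0_def)
qed

lemma mul0_cancel_left:
  assumes eq: "mul0 a b = mul0 a c" and "a [] \<noteq> 0"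
  shows "b = c"
proof
  fix w show "b w = c w"
  proof (induction w rule: length_induct)
    case (1 w)
    show ?case
    proof (cases w)
      case Nil
      then show ?thesis using fun_cong[OF eq, of "[]"] assms(2) by (simp add: mul0_Nil)
    next
      case (Cons i v)
      have "mul0 (\<lambda>v. a (i # v)) b v = mul0 (\<lambda>v. a (i # v)) c v"
        unfolding mul0_def using 1 Cons by (intro sum.cong) auto
      then show ?thesis using fun_cong[OF eq, of w] assms(2) by (simp add: Cons mul0_Cons)
    qed
  qed
qed

lemma
  assumes "mul0 a b = one0"
  shows mul0_inverse_commute: "mul0 b a = one0" and inv0_eq: "inv0 a = b"
proof -
  have "a [] * b [] = 1" using fun_cong[OF assms, of "[]"] by (simp add: mul0_Nil one0_def)
  then have "a [] \<noteq> 0" by auto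
  have "mul0 a (mul0 b a) = mul0 a one0"
    by (simp add: assms mul0_one_left mul0_one_right flip: mul0_assoc)
  then show left: "mul0 b a = one0" by (rule mul0_cancel_left) fact
  show "inv0 a = b"
    unfolding inv0_def
  proof (rule the_equality)
    fix c assume "mul0 a c = one0 \<and> mul0 c a = one0"
    then show "c = b" using mul0_cancel_left[of a c b] assms \<open>a [] \<noteq> 0\<close> by simp
  qed (use assms left in simp)
qed

definition antipode :: "t0 \<Rightarrow> t0" where
  "antipode a w = (-1) ^ length w * a (rev w)"

lemma antipode_one0: "antipode one0 = one0"
  by (auto simp: antipode_def one0_def)

lemma mul0_rev: "mul0 a b (rev w) = mul0 (\<lambda>v. b (rev v)) (\<lambda>v. a (rev v)) w"
  unfolding mul0_def
  by (rule sum.reindex_bij_witness[of _ "\<lambda>k. length w - k" "\<lambda>k. length w - k"])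
    (auto simp: take_rev drop_rev)

lemma antipode_mul0: "antipode (mul0 a b) = mul0 (antipode b) (antipode a)"
proof
  fix w :: "nat list"
  have "(-1 :: real) ^ length w = (-1) ^ length (take k w) * (-1) ^ length (drop k w)" for k
    by (simp only: append_take_drop_id flip: power_add length_append)
  then have "(-1) ^ length w * (b (rev (take k w)) * a (rev (drop k w)))
      = antipode b (take k w) * antipode a (drop k w)" for k
    by (simp add: antipode_def mult_ac)
  then show "antipode (mul0 a b) w = mul0 (antipode b) (antipode a) w"
    unfolding antipode_def[of "mul0 a b"] mul0_rev by (simp add: mul0_def sum_distrib_left)
qed

lemma lact_eq_mul0: "lact a E (u, p, v) = mul0 a (\<lambda>x. E (x, p, v)) u"
  by (simp add: lact_def mul0_def)

lemma ract_eq_mul0: "ract E a (u, p, v) = mul0 (\<lambda>x. E (u, p, x)) a v"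
  by (simp add: ract_def mul0_def)

definition mirror :: "tb \<Rightarrow> tb" where
  "mirror = (\<lambda>(u, p, v). (rev v, p, rev u))"

lemma ract_eq_lact_mirror: "ract E a b = lact (\<lambda>w. a (rev w)) (\<lambda>b. E (mirror b)) (mirror b)"
proof (cases b)
  case (fields u p v)
  then show ?thesis
    using mul0_rev[of "\<lambda>x. E (u, p, x)" a "rev v"]
    by (simp add: mirror_def ract_eq_mul0 lact_eq_mul0)
qed

lemma take_drop_eq_iff: "k \<le> length w \<Longrightarrow> take k w = x \<and> drop k w = y \<longleftrightarrow> k = length x \<and> w = x @ y"
  by (auto simp: append_eq_conv_conj min_def)

lemma mul0_basis_vec: "mul0 (basis_vec x) (basis_vec y) = basis_vec (x @ y)"
proof
  fix w :: "nat list"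
  have "mul0 (basis_vec x) (basis_vec y) w
      = (\<Sum>k\<le>length w. of_bool (take k w = x \<and> drop k w = y))"
    unfolding mul0_def basis_vec_def by (intro sum.cong) auto
  also have "\<dots> = (\<Sum>k\<le>length w. if k = length x then of_bool (w = x @ y) else 0)"
    by (intro sum.cong refl) (simp add: take_drop_eq_iff)
  also have "\<dots> = basis_vec (x @ y) w" by (auto simp: basis_vec_def)
  finally show "mul0 (basis_vec x) (basis_vec y) w = basis_vec (x @ y) w" .
qed

lemma lact_basis_vec: "lact (basis_vec x) (basis_vec (y, p, v)) = basis_vec (x @ y, p, v)"
proof
  fix b :: tb
  obtain u q z where b: "b = (u, q, z)" by (cases b)
  have "(\<lambda>w. basis_vec (y, p, v) (w, q, z)) = (\<lambda>w. of_bool (q = p \<and> z = v) * basis_vec y w)"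
    by (auto simp: basis_vec_def)
  then show "lact (basis_vec x) (basis_vec (y, p, v)) b = basis_vec (x @ y, p, v) b"
    by (auto simp: b lact_eq_mul0 mul0_scale_right mul0_basis_vec) (auto simp: basis_vec_def)
qed

lemma ract_basis_vec: "ract (basis_vec (u, p, x)) (basis_vec y) = basis_vec (u, p, x @ y)"
proof
  fix b :: tb
  obtain z q v where b: "b = (z, q, v)" by (cases b)
  have "(\<lambda>w. basis_vec (u, p, x) (z, q, w)) = (\<lambda>w. of_bool (z = u \<and> q = p) * basis_vec x w)"
    by (auto simp: basis_vec_def)
  then show "ract (basis_vec (u, p, x)) (basis_vec y) b = basis_vec (u, p, x @ y) b"
    by (auto simp: b ract_eq_mul0 mul0_scale_left mul0_basis_vec) (auto simp: basis_vec_def)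
qed

definition wedge_coeff :: "t1 \<Rightarrow> nat list \<Rightarrow> nat \<Rightarrow> nat \<Rightarrow> nat list \<Rightarrow> real" where
  "wedge_coeff E u i j v = (if i < j then E (u, (i, j), v) else if j < i then - E (u, (j, i), v) else 0)"

lemma delta_eq_sum:
  "delta E w = (\<Sum>k<length w - 1. wedge_coeff E (take k w) (w ! k) (w ! (k+1)) (drop (k+2) w))"
  by (simp add: delta_def wedge_coeff_def Let_def)

lemma delta_Nil: "delta E [] = 0" and delta_singleton: "delta E [i] = 0"
  by (simp_all add: delta_eq_sum)

lemma delta_Cons_Cons:
  "delta E (i # j # w) = wedge_coeff E [] i j w + delta (\<lambda>(u, q). E (i # u, q)) (j # w)"
proof -
  have "wedge_coeff (\<lambda>(u, q). E (i # u, q)) u i' j' v = wedge_coeff E (i # u) i' j' v" for u i' j' v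
    by (simp add: wedge_coeff_def)
  then show ?thesis by (simp add: delta_eq_sum sum.lessThan_Suc_shift del: sum.lessThan_Suc)
qed

lemma delta_add: "delta (\<lambda>b. E b + F b) w = delta E w + delta F w"
  unfolding delta_eq_sum sum.distrib[symmetric] by (intro sum.cong) (auto simp: wedge_coeff_def)

lemma delta_scale: "delta (\<lambda>b. c * E b) w = c * delta E w"
  unfolding delta_eq_sum sum_distrib_left by (intro sum.cong) (auto simp: wedge_coeff_def)

lemma delta_lact: "delta (lact a E) w = mul0 a (delta E) w"
proof (induction w arbitrary: a rule: induct_list012)
  case (3 i j w)
  have split: "lact a E (i # u, q) = a [] * E (i # u, q) + lact (\<lambda>v. a (i # v)) E (u, q)" for u q
    by (cases q) (simp add: lact_eq_mul0 mul0_Cons)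
  have head: "wedge_coeff (lact a E) [] i j w = a [] * wedge_coeff E [] i j w"
    by (simp add: wedge_coeff_def lact_eq_mul0 mul0_Nil)
  have "delta (lact a E) (i # j # w) = a [] * wedge_coeff E [] i j w
      + delta (\<lambda>b. a [] * (case b of (u, q) \<Rightarrow> E (i # u, q)) + lact (\<lambda>v. a (i # v)) E b) (j # w)"
    by (simp add: delta_Cons_Cons head split case_prod_unfold)
  also have "\<dots> = a [] * delta E (i # j # w) + delta (lact (\<lambda>v. a (i # v)) E) (j # w)"
    by (simp add: delta_add delta_scale delta_Cons_Cons distrib_left)
  also have "\<dots> = mul0 a (delta E) (i # j # w)" by (simp add: 3 mul0_Cons)
  finally show ?case .
qed (simp_all add: delta_Nil delta_singleton mul0_Nil mul0_Cons)

lemma lact_one_plus_delta: "lact (\<lambda>w. one0 w + delta E w) F b = F b + mul1 E F b"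
  by (cases b) (simp add: mul1_def lact_eq_mul0 mul0_add_left mul0_one_left)

subsection \<open>Analysis of the products\<close>

text \<open>A word of length \<open>n\<close> has \<open>n + 1\<close> splittings, which doubling the radius absorbs.\<close>

lemma abs_mul0_le:
  assumes "0 < \<rho>" and a: "\<And>w. (2 * \<rho>) ^ length w * \<bar>a w\<bar> \<le> A"
    and b: "\<And>w. (2 * \<rho>) ^ length w * \<bar>b w\<bar> \<le> B"
  shows "\<rho> ^ length w * \<bar>mul0 a b w\<bar> \<le> A * B"
proof -
  let ?n = "length w"
  have "0 \<le> A" "0 \<le> B" using a[of "[]"] b[of "[]"] by auto
  have "(2 * \<rho>) ^ ?n * \<bar>mul0 a b w\<bar> \<le> (2 * \<rho>) ^ ?n * (\<Sum>k\<le>?n. \<bar>a (take k w)\<bar> * \<bar>b (drop k w)\<bar>)"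
    using \<open>0 < \<rho>\<close> unfolding mul0_def abs_mult[symmetric] by (intro mult_left_mono sum_abs) simp
  also have "\<dots> = (\<Sum>k\<le>?n. ((2 * \<rho>) ^ length (take k w) * \<bar>a (take k w)\<bar>)
      * ((2 * \<rho>) ^ length (drop k w) * \<bar>b (drop k w)\<bar>))"
    unfolding sum_distrib_left
  proof (intro sum.cong refl)
    fix k
    have "(2 * \<rho>) ^ ?n = (2 * \<rho>) ^ length (take k w) * (2 * \<rho>) ^ length (drop k w)"
      by (simp only: append_take_drop_id flip: power_add length_append)
    then show "(2 * \<rho>) ^ ?n * (\<bar>a (take k w)\<bar> * \<bar>b (drop k w)\<bar>)
        = ((2 * \<rho>) ^ length (take k w) * \<bar>a (take k w)\<bar>)
          * ((2 * \<rho>) ^ length (drop k w) * \<bar>b (drop k w)\<bar>)"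
      by (simp only: mult_ac)
  qed
  also have "\<dots> \<le> (\<Sum>k\<le>?n. A * B)"
    using \<open>0 < \<rho>\<close> \<open>0 \<le> A\<close> by (intro sum_mono mult_mono a b) auto
  also have "\<dots> = real (Suc ?n) * (A * B)" by simp
  also have "\<dots> \<le> 2 ^ ?n * (A * B)"
    using of_nat_mono[OF Suc_leI[OF less_exp[of ?n]], where 'a = real] \<open>0 \<le> A\<close> \<open>0 \<le> B\<close>
    by (intro mult_right_mono) auto
  finally show ?thesis by (simp add: power_mult_distrib mult.assoc)
qed

lemma abs_delta_le:
  assumes "0 < \<rho>" and E: "\<And>b. (2 * \<rho>) ^ level1 b * \<bar>E b\<bar> \<le> B"
  shows "\<rho> ^ length w * \<bar>delta E w\<bar> \<le> B"
proof -
  let ?n = "length w"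
  have "0 \<le> (2 * \<rho>) ^ level1 b * \<bar>E b\<bar>" for b using \<open>0 < \<rho>\<close> by simp
  then have "0 \<le> B" using E order_trans by blast
  have "(2 * \<rho>) ^ ?n * \<bar>delta E w\<bar>
      \<le> (2 * \<rho>) ^ ?n * (\<Sum>k<?n - 1. \<bar>wedge_coeff E (take k w) (w ! k) (w ! (k+1)) (drop (k+2) w)\<bar>)"
    using \<open>0 < \<rho>\<close> unfolding delta_eq_sum by (intro mult_left_mono sum_abs) simp
  also have "\<dots> = (\<Sum>k<?n - 1. (2 * \<rho>) ^ ?n
      * \<bar>wedge_coeff E (take k w) (w ! k) (w ! (k+1)) (drop (k+2) w)\<bar>)"
    by (rule sum_distrib_left)
  also have "\<dots> \<le> (\<Sum>k<?n - 1. B)"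
  proof (rule sum_mono)
    fix k assume "k \<in> {..<?n - 1}"
    then have "level1 (take k w, p, drop (k+2) w) = ?n" for p by (auto simp: level1_def)
    then show "(2 * \<rho>) ^ ?n * \<bar>wedge_coeff E (take k w) (w ! k) (w ! (k+1)) (drop (k+2) w)\<bar> \<le> B"
      using E[of "(take k w, _, drop (k+2) w)"] \<open>0 \<le> B\<close> by (simp add: wedge_coeff_def)
  qed
  also have "\<dots> = real (?n - 1) * B" by simp
  also have "\<dots> \<le> 2 ^ ?n * B"
  proof (rule mult_right_mono[OF _ \<open>0 \<le> B\<close>])
    have "?n - 1 \<le> 2 ^ ?n" using less_exp[of ?n] by linarith
    then show "real (?n - 1) \<le> 2 ^ ?n" by (metis of_nat_le_iff of_nat_numeral of_nat_power)
  qed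
  finally show ?thesis by (simp add: power_mult_distrib mult.assoc)
qed

lemma valid0_take_drop: "valid0 d w \<longleftrightarrow> valid0 d (take k w) \<and> valid0 d (drop k w)"
  by (metis append_take_drop_id le_sup_iff set_append valid0_def)

lemma mul0_support:
  assumes "\<And>w. \<not> valid0 d w \<Longrightarrow> a w = 0" "\<And>w. \<not> valid0 d w \<Longrightarrow> b w = 0" "\<not> valid0 d w"
  shows "mul0 a b w = 0"
  unfolding mul0_def using assms valid0_take_drop[of d w] by (intro sum.neutral) force

lemma delta_support:
  assumes "\<And>b. \<not> valid1 d b \<Longrightarrow> E b = 0" "\<not> valid0 d w"
  shows "delta E w = 0"
  unfolding delta_eq_sum
proof (intro sum.neutral ballI)
  fix k assume "k \<in> {..<length w - 1}"
  then have "drop k w = w ! k # w ! (k+1) # drop (k+2) w" by (simp add: Cons_nth_drop_Suc)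
  then have "\<not> (valid0 d (take k w) \<and> w ! k < d \<and> w ! (k+1) < d \<and> valid0 d (drop (k+2) w))"
    using assms(2) valid0_take_drop[of d w k] by (auto simp: valid0_def)
  then show "wedge_coeff E (take k w) (w ! k) (w ! (k+1)) (drop (k+2) w) = 0"
    using assms(1) by (auto simp: wedge_coeff_def valid1_iff)
qed

lemma uniformly_rapid_mul0:
  assumes a: "T0.uniformly_rapid d T a" and b: "T0.uniformly_rapid d T b"
  shows "T0.uniformly_rapid d T (\<lambda>t. mul0 (a t) (b t))"
proof (rule T0.uniformly_rapidI)
  fix \<rho> :: real assume "0 < \<rho>"
  then have "0 < 2 * \<rho>" by simp
  obtain A where "\<And>t w. t \<in> T \<Longrightarrow> (2 * \<rho>) ^ length w * \<bar>a t w\<bar> \<le> A"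
    by (rule T0.uniformly_rapid_bound[OF a \<open>0 < 2 * \<rho>\<close>]) blast
  moreover obtain B where "\<And>t w. t \<in> T \<Longrightarrow> (2 * \<rho>) ^ length w * \<bar>b t w\<bar> \<le> B"
    by (rule T0.uniformly_rapid_bound[OF b \<open>0 < 2 * \<rho>\<close>]) blast
  ultimately show "\<exists>C. \<forall>t\<in>T. \<forall>w. \<rho> ^ length w * \<bar>mul0 (a t) (b t) w\<bar> \<le> C"
    using abs_mul0_le[OF \<open>0 < \<rho>\<close>] by blast
qed (use mul0_support T0.uniformly_rapid_support[OF a] T0.uniformly_rapid_support[OF b] in blast)

lemma uniformly_rapid_delta:
  assumes E: "T1.uniformly_rapid d T E"
  shows "T0.uniformly_rapid d T (\<lambda>t. delta (E t))"
proof (rule T0.uniformly_rapidI)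
  fix \<rho> :: real assume "0 < \<rho>"
  then have "0 < 2 * \<rho>" by simp
  obtain B where "\<And>t b. t \<in> T \<Longrightarrow> (2 * \<rho>) ^ level1 b * \<bar>E t b\<bar> \<le> B"
    by (rule T1.uniformly_rapid_bound[OF E \<open>0 < 2 * \<rho>\<close>]) blast
  then show "\<exists>B. \<forall>t\<in>T. \<forall>w. \<rho> ^ length w * \<bar>delta (E t) w\<bar> \<le> B"
    using abs_delta_le[OF \<open>0 < \<rho>\<close>] by blast
qed (use delta_support T1.uniformly_rapid_support[OF E] in blast)

lemma abs_rescale_le:
  assumes "0 < \<rho>" "(2 * \<rho>) ^ (m + n) * \<bar>x :: real\<bar> \<le> B"
  shows "(2 * \<rho>) ^ m * \<bar>\<rho> ^ n * x\<bar> \<le> B"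
proof -
  have "(2 * \<rho>) ^ m * \<bar>\<rho> ^ n * x\<bar> = (2 * \<rho>) ^ m * \<rho> ^ n * \<bar>x\<bar>"
    using \<open>0 < \<rho>\<close> by (simp add: abs_mult)
  also have "\<dots> \<le> (2 * \<rho>) ^ m * (2 * \<rho>) ^ n * \<bar>x\<bar>"
    using \<open>0 < \<rho>\<close> by (intro mult_right_mono mult_left_mono power_mono) auto
  also have "\<dots> \<le> B" using assms(2) by (simp only: power_add)
  finally show ?thesis .
qed

lemma uniformly_rapid_lact:
  assumes a: "T0.uniformly_rapid d T a" and E: "T1.uniformly_rapid d T E"
  shows "T1.uniformly_rapid d T (\<lambda>t. lact (a t) (E t))"
proof (rule T1.uniformly_rapidI)
  fix t and b :: tb assume t: "t \<in> T" and b: "\<not> valid1 d b"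
  obtain u i j v where b_eq: "b = (u, (i, j), v)" by (cases b) auto
  have "a t (take k u) * E t (drop k u, (i, j), v) = 0" for k
    using T0.uniformly_rapid_support[OF a t, of "take k u"]
      T1.uniformly_rapid_support[OF E t, of "(drop k u, (i, j), v)"]
      b valid0_take_drop[of d u k] by (auto simp: b_eq valid1_iff)
  then show "lact (a t) (E t) b = 0"
    unfolding b_eq lact_def prod.case by (intro sum.neutral ballI)
next
  fix \<rho> :: real assume "0 < \<rho>"
  then have "0 < 2 * \<rho>" by simp
  obtain A where A: "\<And>t w. t \<in> T \<Longrightarrow> (2 * \<rho>) ^ length w * \<bar>a t w\<bar> \<le> A"
    by (rule T0.uniformly_rapid_bound[OF a \<open>0 < 2 * \<rho>\<close>]) blast
  obtain B where B: "\<And>t b. t \<in> T \<Longrightarrow> (2 * \<rho>) ^ level1 b * \<bar>E t b\<bar> \<le> B"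
    by (rule T1.uniformly_rapid_bound[OF E \<open>0 < 2 * \<rho>\<close>]) blast
  have "\<rho> ^ level1 (u, p, v) * \<bar>lact (a t) (E t) (u, p, v)\<bar> \<le> A * B" if "t \<in> T" for t u p v
  proof -
    have "\<rho> ^ length u * \<bar>mul0 (a t) (\<lambda>x. \<rho> ^ (length v + 2) * E t (x, p, v)) u\<bar> \<le> A * B"
      using B[OF that, of "(_, p, v)"]
      by (intro abs_mul0_le \<open>0 < \<rho>\<close> A that abs_rescale_le) (simp add: level1_def add.assoc)
    then show ?thesis
      using \<open>0 < \<rho>\<close>
      by (simp add: mul0_scale_right lact_eq_mul0 level1_def abs_mult power_add mult_ac)
  qed
  then show "\<exists>C. \<forall>t\<in>T. \<forall>b. \<rho> ^ level1 b * \<bar>lact (a t) (E t) b\<bar> \<le> C" by (metis prod.exhaust)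
qed

lemma uniformly_rapid_ract:
  assumes "T0.uniformly_rapid d T a" "T1.uniformly_rapid d T E"
  shows "T1.uniformly_rapid d T (\<lambda>t. ract (E t) (a t))"
proof -
  have mirror: "level1 (mirror b) = level1 b" "valid1 d (mirror b) \<longleftrightarrow> valid1 d b" for b
    by (auto simp: mirror_def level1_def valid1_def split: prod.splits)
  have "T0.uniformly_rapid d T (\<lambda>t w. a t (rev w))"
    by (rule T0.uniformly_rapid_reindex[OF assms(1)]) (simp_all add: valid0_def)
  moreover have "T1.uniformly_rapid d T (\<lambda>t b. E t (mirror b))"
    by (rule T1.uniformly_rapid_reindex[OF assms(2) mirror])
  ultimately have "T1.uniformly_rapid d T (\<lambda>t. lact (\<lambda>w. a t (rev w)) (\<lambda>b. E t (mirror b)))"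
    by (rule uniformly_rapid_lact)
  from T1.uniformly_rapid_reindex[OF this mirror] show ?thesis
    unfolding ract_eq_lact_mirror[abs_def] .
qed

lemma uniformly_rapid_antipode:
  assumes a: "T0.uniformly_rapid d T a"
  shows "T0.uniformly_rapid d T (\<lambda>t. antipode (a t))"
proof (rule T0.uniformly_rapidI)
  fix \<rho> :: real assume "0 < \<rho>"
  obtain A where "\<And>t w. t \<in> T \<Longrightarrow> \<rho> ^ length w * \<bar>a t w\<bar> \<le> A"
    by (rule T0.uniformly_rapid_bound[OF a \<open>0 < \<rho>\<close>]) blast
  from this[of _ "rev _"] show "\<exists>A. \<forall>t\<in>T. \<forall>w. \<rho> ^ length w * \<bar>antipode (a t) w\<bar> \<le> A"
    by (auto simp: antipode_def abs_mult power_abs)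
qed (simp add: antipode_def T0.uniformly_rapid_support[OF a] valid0_def)

lemma continuous_on_mul0:
  assumes "\<And>w. continuous_on S (\<lambda>t. a t w)" "\<And>w. continuous_on S (\<lambda>t. b t w)"
  shows "continuous_on S (\<lambda>t. mul0 (a t) (b t) w)"
  unfolding mul0_def by (intro continuous_intros assms)

lemma continuous_on_lact:
  assumes "\<And>w. continuous_on S (\<lambda>t. a t w)" "\<And>b. continuous_on S (\<lambda>t. E t b)"
  shows "continuous_on S (\<lambda>t. lact (a t) (E t) b)"
  by (cases b) (simp add: lact_eq_mul0 continuous_on_mul0 assms)

lemma continuous_on_ract:
  assumes "\<And>b. continuous_on S (\<lambda>t. E t b)" "\<And>w. continuous_on S (\<lambda>t. a t w)"
  shows "continuous_on S (\<lambda>t. ract (E t) (a t) b)"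
  by (cases b) (simp add: ract_eq_mul0 continuous_on_mul0 assms)

lemma continuous_on_delta:
  assumes "\<And>b. continuous_on S (\<lambda>t. E t b)"
  shows "continuous_on S (\<lambda>t. delta (E t) w)"
proof -
  have "continuous_on S (\<lambda>t. wedge_coeff (E t) u i j v)" for u i j v
    unfolding wedge_coeff_def
    by (cases "i < j"; cases "j < i") (simp_all add: assms continuous_on_minus)
  then show ?thesis unfolding delta_eq_sum by (intro continuous_on_sum)
qed

lemma has_real_derivative_mul0:
  assumes "\<And>w. ((\<lambda>t. a t w) has_real_derivative a' w) (at t within S)"
    and "\<And>w. ((\<lambda>t. b t w) has_real_derivative b' w) (at t within S)"
  shows "((\<lambda>t. mul0 (a t) (b t) w) has_real_derivative mul0 a' (b t) w + mul0 (a t) b' w)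
      (at t within S)"
  unfolding mul0_def sum.distrib[symmetric]
  by (intro DERIV_sum) (auto intro!: derivative_eq_intros assms)

lemma has_real_derivative_delta:
  assumes "\<And>b. ((\<lambda>t. E t b) has_real_derivative E' b) (at t within S)"
  shows "((\<lambda>t. delta (E t) w) has_real_derivative delta E' w) (at t within S)"
proof -
  have "((\<lambda>t. wedge_coeff (E t) u i j v) has_real_derivative wedge_coeff E' u i j v) (at t within S)"
    for u i j v
    unfolding wedge_coeff_def
    by (cases "i < j"; cases "j < i") (auto intro!: derivative_eq_intros assms)
  then show ?thesis unfolding delta_eq_sum by (intro DERIV_sum)
qed

lemma has_real_derivative_antipode:
  assumes "\<And>w. ((\<lambda>t. a t w) has_real_derivative a' w) (at t within S)"
  shows "((\<lambda>t. antipode (a t) w) has_real_derivative antipode a' w) (at t within S)"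
  unfolding antipode_def by (intro DERIV_cmult assms)

section \<open>Linear differential equations\<close>

lemma has_integral_exp_growth:
  fixes K :: real
  assumes "a \<le> b"
  shows "((\<lambda>x. K * exp (K * (x - a))) has_integral exp (K * (b - a)) - 1) {a..b}"
proof -
  have "((\<lambda>x. exp (K * (x - a))) has_vector_derivative K * exp (K * (x - a))) (at x within {a..b})"
    for x
    unfolding has_real_derivative_iff_has_vector_derivative[symmetric]
    by (auto intro!: derivative_eq_intros)
  from fundamental_theorem_of_calculus[OF assms this] show ?thesis by simp
qed

text \<open>In the supremum norm with weight \<open>exp (- 2 C (t - a))\<close>, integrating the bound on the derivative
  halves the norm of \<open>D\<close>.\<close>

lemma norm_derivative_le_imp_zero:
  fixes D :: "real \<Rightarrow> 'a::banach"
  assumes cont: "continuous_on {a..b} D" and "D a = 0" and "finite S"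
    and deriv: "\<And>t. t \<in> {a..b} - S \<Longrightarrow> (D has_vector_derivative D' t) (at t within {a..b})"
    and bound: "\<And>t. t \<in> {a..b} - S \<Longrightarrow> norm (D' t) \<le> C * norm (D t)" and t: "t \<in> {a..b}"
  shows "D t = 0"
proof -
  define K where "K = 2 * \<bar>C\<bar>"
  let ?E = "\<lambda>t. exp (K * (t - a))"
  have "continuous_on {a..b} (\<lambda>\<tau>. norm (D \<tau>) / ?E \<tau>)" by (intro continuous_intros cont) simp
  then obtain t0 where t0: "t0 \<in> {a..b}"
      and max: "\<And>\<tau>. \<tau> \<in> {a..b} \<Longrightarrow> norm (D \<tau>) / ?E \<tau> \<le> norm (D t0) / ?E t0"
    using continuous_attains_sup[of "{a..b}" "\<lambda>\<tau>. norm (D \<tau>) / ?E \<tau>"] t by auto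
  define m where "m = norm (D t0) / ?E t0"
  have le: "norm (D \<tau>) \<le> m * ?E \<tau>" if "\<tau> \<in> {a..b}" for \<tau>
    using max[OF that] by (simp add: m_def pos_divide_le_eq)
  have "0 \<le> m" by (simp add: m_def)
  define f where "f \<tau> = (if \<tau> \<in> S then 0 else D' \<tau>)" for \<tau>
  have f: "(f has_integral D t0 - D a) {a..t0}"
  proof (rule fundamental_theorem_of_calculus_interior_strong[OF \<open>finite S\<close>])
    show "continuous_on {a..t0} D" using t0 by (auto intro: continuous_on_subset[OF cont])
    show "(D has_vector_derivative f \<tau>) (at \<tau>)" if "\<tau> \<in> {a<..<t0} - S" for \<tau>
      using deriv[of \<tau>] that t0 by (simp add: f_def at_within_Icc_at)
  qed (use t0 in auto)
  have "norm (f \<tau>) \<le> m / 2 * (K * ?E \<tau>)" if "\<tau> \<in> {a..t0}" for \<tau>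
  proof (cases "\<tau> \<in> S")
    case False
    have "norm (f \<tau>) \<le> C * norm (D \<tau>)" using bound[of \<tau>] that t0 False by (simp add: f_def)
    also have "\<dots> \<le> \<bar>C\<bar> * (m * ?E \<tau>)" using le[of \<tau>] that t0 by (intro mult_mono) auto
    finally show ?thesis by (simp add: K_def mult_ac)
  qed (use \<open>0 \<le> m\<close> in \<open>simp add: f_def K_def\<close>)
  moreover have bound_int: "((\<lambda>\<tau>. m / 2 * (K * ?E \<tau>)) has_integral m / 2 * (?E t0 - 1)) {a..t0}"
    using t0 by (intro has_integral_mult_right has_integral_exp_growth) simp
  ultimately have "norm (D t0 - D a) \<le> m / 2 * (?E t0 - 1)"
    using integral_norm_bound_integral[OF has_integral_integrable[OF f]
        has_integral_integrable[OF bound_int]]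
    by (simp only: integral_unique[OF f] integral_unique[OF bound_int])
  then have "m * ?E t0 \<le> m / 2 * (?E t0 - 1)" using \<open>D a = 0\<close> by (simp add: m_def)
  then have "m * (?E t0 + 1) \<le> 0" by (simp add: field_simps)
  then have "m \<le> 0" using exp_gt_zero[of "K * (t0 - a)"] by (auto simp: mult_le_0_iff)
  then show ?thesis using le[OF t] \<open>0 \<le> m\<close> by simp
qed

lemma has_real_derivative_eq_imp_eq:
  fixes f g :: "real \<Rightarrow> real"
  assumes "\<And>t. t \<in> {a..b} \<Longrightarrow> (f has_real_derivative f' t) (at t within {a..b})"
    and "\<And>t. t \<in> {a..b} \<Longrightarrow> (g has_real_derivative f' t) (at t within {a..b})"
    and "f a = g a" "t \<in> {a..b}"
  shows "f t = g t"
proof -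
  have "((\<lambda>t. f t - g t) has_real_derivative 0) (at t within {a..b})" if "t \<in> {a..b}" for t
    using DERIV_diff[OF assms(1)[OF that] assms(2)[OF that]] by simp
  from has_field_derivative_zero_constant[OF convex_real_interval(5) this]
  obtain c where "\<And>t. t \<in> {a..b} \<Longrightarrow> f t - g t = c" by blast
  from this[of a] this[of t] show ?thesis using assms(3,4) by simp
qed

lemma continuous_on_integral_upto:
  fixes f :: "'s::topological_space \<times> real \<Rightarrow> real"
  assumes f: "continuous_on (S \<times> {a..b}) f"
  shows "continuous_on (S \<times> {a..b}) (\<lambda>z. integral {a..snd z} (\<lambda>y. f (fst z, y)))"
proof -
  have between: "a + x * (t - a) \<in> {a..t}" if "t \<in> {a..b}" "x \<in> {0..1}" for x t
  proof -
    have "0 \<le> x * (t - a)" "x * (t - a) \<le> t - a" using that by (auto intro: mult_left_le_one_le)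
    then show ?thesis by auto
  qed
  have eq: "integral {a..t} (\<lambda>y. f (s, y))
      = integral (cbox 0 1) (\<lambda>x. (t - a) * f (s, a + x * (t - a)))"
    if "s \<in> S" "t \<in> {a..b}" for s t
  proof -
    have "((\<lambda>x. (t - a) *\<^sub>R f (s, a + x * (t - a))) has_integral
        integral {a + 0 * (t - a)..a + 1 * (t - a)} (\<lambda>y. f (s, y))) {0..1}"
    proof (rule has_integral_substitution[where c = a and d = t])
      show "(\<lambda>x. a + x * (t - a)) ` {0..1} \<subseteq> {a..t}" using between[OF that(2)] by blast
      show "continuous_on {a..t} (\<lambda>y. f (s, y))"
        using that by (intro continuous_on_compose2[OF f]) (auto intro!: continuous_intros)
    qed (use that in \<open>auto intro!: derivative_eq_intros\<close>)
    from integral_unique[OF this] show ?thesis by simp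
  qed
  have "continuous_on ((S \<times> {a..b}) \<times> cbox 0 1)
      (\<lambda>(z, x). (snd z - a) * f (fst z, a + x * (snd z - a)))"
    unfolding case_prod_unfold using between
    by (intro continuous_intros continuous_on_compose2[OF f]) fastforce+
  from integral_continuous_on_param[OF this] show ?thesis
    by (rule continuous_on_eq) (use eq in auto)
qed

subsection \<open>Linear equations in the tensor algebra\<close>

definition solves_linear :: "(real \<Rightarrow> t0) \<Rightarrow> real \<Rightarrow> real \<Rightarrow> (real \<Rightarrow> t0) \<Rightarrow> bool" where
  "solves_linear H a b Y \<longleftrightarrow> (\<forall>t\<in>{a..b}. \<forall>w.
     ((\<lambda>t. Y t w) has_real_derivative mul0 (Y t) (H t) w) (at t within {a..b}))"

lemma solves_linearD:
  "solves_linear H a b Y \<Longrightarrow> t \<in> {a..b} \<Longrightarrow>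
    ((\<lambda>t. Y t w) has_real_derivative mul0 (Y t) (H t) w) (at t within {a..b})"
  by (simp add: solves_linear_def)

lemma solves_linear_continuous: "solves_linear H a b Y \<Longrightarrow> continuous_on {a..b} (\<lambda>t. Y t w)"
  using DERIV_continuous solves_linearD unfolding continuous_on_eq_continuous_within by blast

lemma mul0_eq_proper_sum:
  "h [] = 0 \<Longrightarrow> mul0 a h w = (\<Sum>k<length w. a (take k w) * h (drop k w))"
  by (simp add: mul0_def flip: lessThan_Suc_atMost)

lemma solves_linear_unique:
  assumes Y: "solves_linear H a b Y" and Z: "solves_linear H a b Z" and "Y a = Z a"
    and H: "\<And>t. t \<in> {a..b} \<Longrightarrow> H t [] = 0" and t: "t \<in> {a..b}"
  shows "Y t = Z t"
proof
  fix w show "Y t w = Z t w"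
    using t
  proof (induction "length w" arbitrary: w t rule: less_induct)
    case less
    have "mul0 (Z \<tau>) (H \<tau>) w = mul0 (Y \<tau>) (H \<tau>) w" if "\<tau> \<in> {a..b}" for \<tau>
      using less.hyps that H by (auto simp: mul0_eq_proper_sum intro!: sum.cong)
    then have "((\<lambda>t. Z t w) has_real_derivative mul0 (Y \<tau>) (H \<tau>) w) (at \<tau> within {a..b})"
      if "\<tau> \<in> {a..b}" for \<tau>
      using solves_linearD[OF Z that, of w] that by simp
    from has_real_derivative_eq_imp_eq[OF solves_linearD[OF Y] this _ less.prems]
    show ?case using \<open>Y a = Z a\<close> by simp
  qed
qed

declare sum.cong [fundef_cong]

function linear_solution :: "(real \<Rightarrow> t0) \<Rightarrow> real \<Rightarrow> t0 \<Rightarrow> real \<Rightarrow> t0" where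
  "linear_solution H a y t w = y w
     + integral {a..t} (\<lambda>\<tau>. \<Sum>k<length w. linear_solution H a y \<tau> (take k w) * H \<tau> (drop k w))"
  by pat_completeness simp
termination by (relation "Wellfounded.measure (\<lambda>(H, a, y, t, w). length w)") simp_all

declare linear_solution.simps [simp del]

lemma linear_solution_start: "linear_solution H a y a = y"
  by (rule ext, subst linear_solution.simps) simp

lemma continuous_on_linear_solution_param:
  fixes H :: "'s::topological_space \<Rightarrow> real \<Rightarrow> t0"
  assumes y: "\<And>w. continuous_on S (\<lambda>s. y s w)"
    and H: "\<And>w. continuous_on (S \<times> {a..b}) (\<lambda>z. H (fst z) (snd z) w)"
  shows "continuous_on (S \<times> {a..b}) (\<lambda>z. linear_solution (H (fst z)) a (y (fst z)) (snd z) w)"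
proof (induction "length w" arbitrary: w rule: less_induct)
  case less
  let ?f = "\<lambda>z. \<Sum>k<length w. linear_solution (H (fst z)) a (y (fst z)) (snd z) (take k w)
      * H (fst z) (snd z) (drop k w)"
  have "continuous_on (S \<times> {a..b}) (\<lambda>z. integral {a..snd z} (\<lambda>\<tau>. ?f (fst z, \<tau>)))"
    by (intro continuous_on_integral_upto continuous_on_sum continuous_on_mult less H) auto
  moreover have "continuous_on (S \<times> {a..b}) (\<lambda>z. y (fst z) w)"
    by (rule continuous_on_compose2[OF y]) (auto intro!: continuous_intros)
  ultimately show ?case
    by (subst linear_solution.simps) (simp add: continuous_on_add)
qed

lemma sum_half_powers_le: "(\<Sum>k<n. (1/2 :: real) ^ (n - k)) \<le> 1"
proof -
  have "(\<Sum>k<n. (1/2 :: real) ^ (n - k)) = (\<Sum>k<n. (1/2) ^ Suc (n - Suc k))"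
    by (intro sum.cong) (auto simp: Suc_diff_Suc simp del: power_Suc)
  also have "\<dots> = (\<Sum>k<n. (1/2) ^ Suc k)" by (rule sum.nat_diff_reindex)
  also have "\<dots> = 1 - (1/2) ^ n" by (induction n) simp_all
  finally show ?thesis by simp
qed

lemma abs_proper_sum_le:
  fixes y h :: t0
  assumes "0 < \<rho>" "0 \<le> M" "0 \<le> K"
    and y: "\<And>k. k < length w \<Longrightarrow> \<rho> ^ k * \<bar>y (take k w)\<bar> \<le> M"
    and h: "\<And>v. (2 * \<rho>) ^ length v * \<bar>h v\<bar> \<le> K"
  shows "\<rho> ^ length w * \<bar>\<Sum>k<length w. y (take k w) * h (drop k w)\<bar> \<le> M * K"
proof -
  let ?n = "length w"
  have "\<rho> ^ ?n * \<bar>\<Sum>k<?n. y (take k w) * h (drop k w)\<bar>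
      \<le> (\<Sum>k<?n. \<rho> ^ ?n * (\<bar>y (take k w)\<bar> * \<bar>h (drop k w)\<bar>))"
    using \<open>0 < \<rho>\<close> unfolding sum_distrib_left[symmetric] abs_mult[symmetric]
    by (intro mult_left_mono sum_abs) simp
  also have "\<dots> \<le> (\<Sum>k<?n. M * (K * (1/2) ^ (?n - k)))"
  proof (rule sum_mono)
    fix k assume k: "k \<in> {..<?n}"
    have "\<rho> ^ (?n - k) * \<bar>h (drop k w)\<bar> = (2 * \<rho>) ^ (?n - k) * \<bar>h (drop k w)\<bar> * (1/2) ^ (?n - k)"
      by (simp add: power_mult_distrib power_one_over)
    also have "\<dots> \<le> K * (1/2) ^ (?n - k)"
      using h[of "drop k w"] by (intro mult_right_mono) auto
    finally have "(\<rho> ^ k * \<bar>y (take k w)\<bar>) * (\<rho> ^ (?n - k) * \<bar>h (drop k w)\<bar>)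
        \<le> M * (K * (1/2) ^ (?n - k))"
      using k \<open>0 < \<rho>\<close> \<open>0 \<le> M\<close> by (intro mult_mono[OF y]) simp_all
    moreover have "\<rho> ^ ?n = \<rho> ^ k * \<rho> ^ (?n - k)" using k by (simp flip: power_add)
    ultimately show "\<rho> ^ ?n * (\<bar>y (take k w)\<bar> * \<bar>h (drop k w)\<bar>) \<le> M * (K * (1/2) ^ (?n - k))"
      by (simp add: mult_ac)
  qed
  also have "\<dots> = M * K * (\<Sum>k<?n. (1/2) ^ (?n - k))" by (simp add: sum_distrib_left mult.assoc)
  also have "\<dots> \<le> M * K" using assms(2,3) by (intro mult_left_le sum_half_powers_le) simp
  finally show ?thesis .
qed

context
  fixes H :: "real \<Rightarrow> t0" and a b :: real
  assumes H_cont: "\<And>w. continuous_on {a..b} (\<lambda>t. H t w)"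
begin

lemma continuous_on_linear_solution: "continuous_on {a..b} (\<lambda>t. linear_solution H a y t w)"
proof -
  have "continuous_on ({0::real} \<times> {a..b}) (\<lambda>z. linear_solution H a y (snd z) w)"
    by (intro continuous_on_linear_solution_param continuous_on_const
      continuous_on_compose2[OF H_cont])
      (auto intro!: continuous_intros)
  from continuous_on_compose2[OF this, of "{a..b}" "\<lambda>t. (0, t)"] show ?thesis
    by (simp add: continuous_on_Pair image_subset_iff)
qed

lemma continuous_on_linear_solution_integrand:
  "continuous_on {a..b} (\<lambda>\<tau>. \<Sum>k<length w. linear_solution H a y \<tau> (take k w) * H \<tau> (drop k w))"
  by (intro continuous_on_sum continuous_on_mult continuous_on_linear_solution H_cont)

lemma linear_solution_solves:
  assumes proper: "\<And>t. t \<in> {a..b} \<Longrightarrow> H t [] = 0"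
  shows "solves_linear H a b (linear_solution H a y)"
  unfolding solves_linear_def
proof (intro ballI allI)
  fix t w assume t: "t \<in> {a..b}"
  let ?f = "\<lambda>\<tau>. \<Sum>k<length w. linear_solution H a y \<tau> (take k w) * H \<tau> (drop k w)"
  have "((\<lambda>t. y w + integral {a..t} ?f) has_real_derivative 0 + ?f t) (at t within {a..b})"
    using integral_has_vector_derivative[OF continuous_on_linear_solution_integrand t]
    by (intro DERIV_add DERIV_const) (simp only: has_real_derivative_iff_has_vector_derivative)
  then show "((\<lambda>t. linear_solution H a y t w) has_real_derivative
      mul0 (linear_solution H a y t) (H t) w) (at t within {a..b})"
    by (simp add: mul0_eq_proper_sum[of "H t", OF proper[OF t]] flip: linear_solution.simps)
qed

lemma linear_solution_support:
  assumes "\<And>w. \<not> valid0 d w \<Longrightarrow> y w = 0" "\<And>t w. t \<in> {a..b} \<Longrightarrow> \<not> valid0 d w \<Longrightarrow> H t w = 0"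
    and "\<not> valid0 d w" "t \<in> {a..b}"
  shows "linear_solution H a y t w = 0"
  using assms(3,4)
proof (induction "length w" arbitrary: w t rule: less_induct)
  case less
  have "(\<Sum>k<length w. linear_solution H a y \<tau> (take k w) * H \<tau> (drop k w)) = 0" if "\<tau> \<in> {a..t}" for \<tau>
  proof (intro sum.neutral ballI)
    fix k assume "k \<in> {..<length w}"
    then show "linear_solution H a y \<tau> (take k w) * H \<tau> (drop k w) = 0"
      using less.hyps[of "take k w" \<tau>] assms(2)[of \<tau> "drop k w"] valid0_take_drop[of d w k]
        less.prems that by auto
  qed
  then have "integral {a..t} (\<lambda>\<tau>. \<Sum>k<length w. linear_solution H a y \<tau> (take k w) * H \<tau> (drop k w))
      = integral {a..t} (\<lambda>_. 0)" by (intro integral_cong)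
  then show ?case using assms(1) less.prems by (subst linear_solution.simps) simp
qed

lemma abs_linear_solution_le:
  assumes "0 < \<rho>" and y: "\<And>w. \<rho> ^ length w * \<bar>y w\<bar> \<le> M"
    and H: "\<And>t w. t \<in> {a..b} \<Longrightarrow> (2 * \<rho>) ^ length w * \<bar>H t w\<bar> \<le> K" and t: "t \<in> {a..b}"
  shows "\<rho> ^ length w * \<bar>linear_solution H a y t w\<bar> \<le> M * exp (K * (t - a))"
  using t
proof (induction "length w" arbitrary: w t rule: less_induct)
  case less
  let ?n = "length w" and ?Y = "linear_solution H a y"
  let ?f = "\<lambda>\<tau>. \<Sum>k<?n. ?Y \<tau> (take k w) * H \<tau> (drop k w)"
  have "0 \<le> M" "0 \<le> K" using y[of "[]"] H[OF less.prems, of "[]"] by auto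
  have f_bound: "norm (?f \<tau>) \<le> M / \<rho> ^ ?n * (K * exp (K * (\<tau> - a)))" if "\<tau> \<in> {a..t}" for \<tau>
  proof -
    have "\<tau> \<in> {a..b}" using that less.prems by auto
    then have "\<rho> ^ ?n * \<bar>?f \<tau>\<bar> \<le> M * exp (K * (\<tau> - a)) * K"
      using less.hyps[of "take _ w" \<tau>] \<open>0 \<le> M\<close> \<open>0 \<le> K\<close>
      by (intro abs_proper_sum_le \<open>0 < \<rho>\<close> H) auto
    then show ?thesis using \<open>0 < \<rho>\<close> by (simp add: field_simps)
  qed
  have f_integrable: "?f integrable_on {a..t}"
    using less.prems by (intro integrable_continuous_interval
        continuous_on_subset[OF continuous_on_linear_solution_integrand]) auto
  have exp: "((\<lambda>\<tau>. M / \<rho> ^ ?n * (K * exp (K * (\<tau> - a))))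
      has_integral M / \<rho> ^ ?n * (exp (K * (t - a)) - 1)) {a..t}"
    using less.prems by (intro has_integral_mult_right has_integral_exp_growth) simp
  have "norm (integral {a..t} ?f) \<le> M / \<rho> ^ ?n * (exp (K * (t - a)) - 1)"
    using integral_norm_bound_integral[OF f_integrable has_integral_integrable[OF exp] f_bound]
    by (simp only: integral_unique[OF exp])
  then have "\<rho> ^ ?n * \<bar>integral {a..t} ?f\<bar> \<le> M * (exp (K * (t - a)) - 1)"
    using \<open>0 < \<rho>\<close> by (simp add: field_simps)
  moreover have "\<rho> ^ ?n * \<bar>?Y t w\<bar> \<le> \<rho> ^ ?n * \<bar>y w\<bar> + \<rho> ^ ?n * \<bar>integral {a..t} ?f\<bar>"
    using \<open>0 < \<rho>\<close> unfolding linear_solution.simps[of H a y t w] distrib_left[symmetric]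
    by (intro mult_left_mono abs_triangle_ineq) simp
  ultimately show ?case using y[of w] by (simp add: right_diff_distrib)
qed

end

lemma uniformly_rapid_linear_solution:
  assumes y: "T0.uniformly_rapid d S y" and H: "T0.uniformly_rapid d (S \<times> {a..b}) (\<lambda>(s, t). H s t)"
    and cont: "\<And>s w. s \<in> S \<Longrightarrow> continuous_on {a..b} (\<lambda>t. H s t w)"
  shows "T0.uniformly_rapid d (S \<times> {a..b}) (\<lambda>(s, t). linear_solution (H s) a (y s) t)"
proof (rule T0.uniformly_rapidI)
  fix z w assume z: "z \<in> S \<times> {a..b}" "\<not> valid0 d w"
  have "H s t w = 0" if "s \<in> S" "t \<in> {a..b}" "\<not> valid0 d w" for s t w
    using T0.uniformly_rapid_support[OF H, of "(s, t)"] that by simp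
  then show "(case z of (s, t) \<Rightarrow> linear_solution (H s) a (y s) t) w = 0"
    using z T0.uniformly_rapid_support[OF y] cont
    by (auto intro!: linear_solution_support[where b = b and d = d])
next
  fix \<rho> :: real assume "0 < \<rho>"
  then have "0 < 2 * \<rho>" by simp
  obtain M where M: "0 \<le> M" "\<And>s w. s \<in> S \<Longrightarrow> \<rho> ^ length w * \<bar>y s w\<bar> \<le> M"
    by (rule T0.uniformly_rapid_bound[OF y \<open>0 < \<rho>\<close>]) blast
  obtain K where K: "0 \<le> K"
      "\<And>z w. z \<in> S \<times> {a..b} \<Longrightarrow> (2 * \<rho>) ^ length w * \<bar>(case z of (s, t) \<Rightarrow> H s t) w\<bar> \<le> K"
    by (rule T0.uniformly_rapid_bound[OF H \<open>0 < 2 * \<rho>\<close>]) blast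
  have "\<rho> ^ length w * \<bar>linear_solution (H s) a (y s) t w\<bar> \<le> M * exp (K * (b - a))"
    if "s \<in> S" "t \<in> {a..b}" for s t w
  proof -
    have "\<rho> ^ length w * \<bar>linear_solution (H s) a (y s) t w\<bar> \<le> M * exp (K * (t - a))"
      using K(2)[of "(s, _)"] that
      by (intro abs_linear_solution_le[where b = b] cont \<open>0 < \<rho>\<close> M(2)) auto
    also have "\<dots> \<le> M * exp (K * (b - a))"
      using that K(1) M(1) by (intro mult_left_mono) (auto intro!: mult_left_mono)
    finally show ?thesis .
  qed
  then show "\<exists>B. \<forall>z\<in>S \<times> {a..b}. \<forall>w.
      \<rho> ^ length w * \<bar>(case z of (s, t) \<Rightarrow> linear_solution (H s) a (y s) t) w\<bar> \<le> B"
    by (intro exI[of _ "M * exp (K * (b - a))"]) auto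
qed

lemma uniformly_rapid_linear_solution_one0:
  assumes H: "T0.uniformly_rapid d {a..b} H" and cont: "\<And>w. continuous_on {a..b} (\<lambda>t. H t w)"
  shows "T0.uniformly_rapid d {a..b} (linear_solution H a one0)"
proof -
  have "T0.uniformly_rapid d {()} (\<lambda>_. one0)"
    by (rule T0.uniformly_rapid_finite_support[of "{[]}"]) (auto simp: one0_def valid0_def)
  moreover have "T0.uniformly_rapid d ({()} \<times> {a..b}) (\<lambda>(_, t). H t)"
    unfolding case_prod_unfold by (rule T0.uniformly_rapid_compose[OF H]) auto
  ultimately have "T0.uniformly_rapid d ({()} \<times> {a..b}) (\<lambda>(_, t). linear_solution H a one0 t)"
    by (rule uniformly_rapid_linear_solution) (rule cont)
  from T0.uniformly_rapid_compose[OF this, of "{a..b}" "Pair ()"] show ?thesis by simp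
qed

subsection \<open>Equations driven by vectors\<close>

definition of_vector :: "nat \<Rightarrow> (nat \<Rightarrow> real) \<Rightarrow> t0" where
  "of_vector d v w = (if length w = 1 \<and> hd w < d then v (hd w) else 0)"

lemma of_vector_Nil: "of_vector d v [] = 0"
  by (simp add: of_vector_def)

lemma mul0_of_vector_snoc: "mul0 a (of_vector d v) (u @ [i]) = a u * (if i < d then v i else 0)"
proof -
  have "mul0 a (of_vector d v) (u @ [i])
      = (\<Sum>k<length (u @ [i]). if k = length u then a u * (if i < d then v i else 0) else 0)"
    unfolding mul0_eq_proper_sum[of "of_vector d v", OF of_vector_Nil]
    by (intro sum.cong) (auto simp: of_vector_def)
  then show ?thesis by simp
qed

lemma antipode_of_vector: "antipode (of_vector d v) = (\<lambda>w. - of_vector d v w)"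
proof
  fix w show "antipode (of_vector d v) w = - of_vector d v w"
    by (cases w rule: rev_cases) (auto simp: antipode_def of_vector_def)
qed

lemma of_vector_eq: "of_vector d v = (\<lambda>w. if w \<in> (\<lambda>i. [i]) ` {..<d} then v (hd w) else 0)"
  by (auto simp: of_vector_def fun_eq_iff length_Suc_conv)

lemma uniformly_rapid_of_vector:
  assumes "\<And>i. i < d \<Longrightarrow> bounded ((\<lambda>t. v t i) ` T)"
  shows "T0.uniformly_rapid d T (\<lambda>t. of_vector d (v t))"
  by (rule T0.uniformly_rapid_finite_support[of "(\<lambda>i. [i]) ` {..<d}"])
    (use assms in \<open>auto simp: of_vector_eq valid0_def\<close>)

lemma continuous_on_of_vector:
  assumes "\<And>i. i < d \<Longrightarrow> continuous_on S (\<lambda>t. v t i)"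
  shows "continuous_on S (\<lambda>t. of_vector d (v t) w)"
proof (cases "length w = 1 \<and> hd w < d")
  case False
  then have "of_vector d (v t) w = 0" for t unfolding of_vector_def by (rule if_not_P)
  then show ?thesis by simp
qed (use assms in \<open>simp add: of_vector_def\<close>)

lemma mul0_antipode_eq_one0:
  assumes Y: "solves_linear (\<lambda>t. of_vector d (v t)) a b Y"
    and start: "mul0 (Y a) (antipode (Y a)) = one0" and t: "t \<in> {a..b}"
  shows "mul0 (Y t) (antipode (Y t)) = one0"
proof
  fix w
  have "((\<lambda>t. mul0 (Y t) (antipode (Y t)) w) has_real_derivative 0) (at t within {a..b})"
    if t: "t \<in> {a..b}" for t
  proof -
    let ?Y = "Y t" and ?S = "antipode (Y t)" and ?V = "of_vector d (v t)"
    have "((\<lambda>t. mul0 (Y t) (antipode (Y t)) w) has_real_derivative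
        mul0 (mul0 ?Y ?V) ?S w + mul0 ?Y (antipode (mul0 ?Y ?V)) w) (at t within {a..b})"
      by (intro has_real_derivative_mul0 has_real_derivative_antipode solves_linearD[OF Y t])
    also have "antipode (mul0 ?Y ?V) = (\<lambda>w. - mul0 ?V ?S w)"
      by (simp add: antipode_mul0 antipode_of_vector mul0_uminus_left fun_eq_iff)
    finally show ?thesis by (simp add: mul0_uminus_right mul0_assoc)
  qed
  from has_real_derivative_eq_imp_eq[OF this DERIV_const _ t, of "one0 w"]
  show "mul0 (Y t) (antipode (Y t)) w = one0 w" by (simp add: start)
qed

subsection \<open>The equation of the surface signature\<close>

definition solves_surface :: "(real \<Rightarrow> t1) \<Rightarrow> real \<Rightarrow> real \<Rightarrow> (real \<Rightarrow> t1) \<Rightarrow> bool" where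
  "solves_surface G a b Q \<longleftrightarrow> (\<forall>t\<in>{a..b}. \<forall>e.
     ((\<lambda>t. Q t e) has_real_derivative G t e + mul1 (Q t) (G t) e) (at t within {a..b}))"

lemma solves_surfaceD:
  "solves_surface G a b Q \<Longrightarrow> t \<in> {a..b} \<Longrightarrow>
    ((\<lambda>t. Q t e) has_real_derivative lact (\<lambda>w. one0 w + delta (Q t) w) (G t) e) (at t within {a..b})"
  unfolding solves_surface_def lact_one_plus_delta by blast

lemma solves_surface_boundary:
  assumes "solves_surface G a b Q"
  shows "solves_linear (\<lambda>t. delta (G t)) a b (\<lambda>t w. one0 w + delta (Q t) w)"
  unfolding solves_linear_def
proof (intro ballI allI)
  fix t w assume "t \<in> {a..b}"
  then have "((\<lambda>t. delta (Q t) w) has_real_derivative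
      delta (lact (\<lambda>w. one0 w + delta (Q t) w) (G t)) w)
      (at t within {a..b})"
    by (intro has_real_derivative_delta solves_surfaceD[OF assms])
  from DERIV_add[OF DERIV_const this]
  show "((\<lambda>t. one0 w + delta (Q t) w) has_real_derivative
      mul0 (\<lambda>w. one0 w + delta (Q t) w) (delta (G t)) w) (at t within {a..b})"
    by (simp add: delta_lact)
qed

lemma solves_surface_unique:
  assumes Q: "solves_surface G a b Q" and R: "solves_surface G a b R" and "Q a = R a" "t \<in> {a..b}"
  shows "Q t = R t"
proof
  fix e
  have "(\<lambda>w. one0 w + delta (R \<tau>) w) = (\<lambda>w. one0 w + delta (Q \<tau>) w)" if "\<tau> \<in> {a..b}" for \<tau>
    by (rule solves_linear_unique[OF solves_surface_boundary[OF R]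
        solves_surface_boundary[OF Q] _ _ that])
      (simp_all add: assms(3) delta_Nil)
  then have "((\<lambda>t. R t e) has_real_derivative lact (\<lambda>w. one0 w + delta (Q \<tau>) w) (G \<tau>) e)
      (at \<tau> within {a..b})"
    if "\<tau> \<in> {a..b}" for \<tau>
    using solves_surfaceD[OF R that] that by simp
  from has_real_derivative_eq_imp_eq[OF solves_surfaceD[OF Q] this _ assms(4)]
  show "Q t e = R t e" using assms(3) by simp
qed

text \<open>For \<open>P = 1 + \<delta>(Q)\<close>, the equation \<open>Q' = G + Q * G\<close> splits into the linear equation
  \<open>P' = P \<cdot> \<delta>(G)\<close> and the integral of \<open>Q' = P \<cdot> G\<close>.\<close>

locale surface_equation =
  fixes d :: nat and a b :: real and G :: "real \<Rightarrow> t1"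
  assumes G_rapid: "T1.uniformly_rapid d {a..b} G"
    and G_continuous: "\<And>e. continuous_on {a..b} (\<lambda>t. G t e)"
begin

definition boundary :: "real \<Rightarrow> t0" where
  "boundary = linear_solution (\<lambda>t. delta (G t)) a one0"

definition solution :: "real \<Rightarrow> t1" where
  "solution t e = integral {a..t} (\<lambda>\<tau>. lact (boundary \<tau>) (G \<tau>) e)"

lemma boundary_continuous: "continuous_on {a..b} (\<lambda>t. boundary t w)"
  unfolding boundary_def by (intro continuous_on_linear_solution continuous_on_delta G_continuous)

lemma solution_start: "solution a = (\<lambda>e. 0)"
  by (simp add: solution_def fun_eq_iff)

lemma integrand_continuous: "continuous_on {a..b} (\<lambda>\<tau>. lact (boundary \<tau>) (G \<tau>) e)"
  by (intro continuous_on_lact boundary_continuous G_continuous)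

lemma solution_deriv:
  "t \<in> {a..b} \<Longrightarrow> ((\<lambda>t. solution t e) has_real_derivative lact (boundary t) (G t) e)
      (at t within {a..b})"
  unfolding solution_def has_real_derivative_iff_has_vector_derivative
  by (rule integral_has_vector_derivative[OF integrand_continuous])

lemma boundary_eq:
  assumes t: "t \<in> {a..b}"
  shows "boundary t = (\<lambda>w. one0 w + delta (solution t) w)"
proof
  fix w
  have solution: "((\<lambda>t. one0 w + delta (solution t) w)
      has_real_derivative mul0 (boundary \<tau>) (delta (G \<tau>)) w)
      (at \<tau> within {a..b})" if "\<tau> \<in> {a..b}" for \<tau>
  proof -
    have "((\<lambda>t. delta (solution t) w) has_real_derivative delta (lact (boundary \<tau>) (G \<tau>)) w)
        (at \<tau> within {a..b})"
      by (intro has_real_derivative_delta solution_deriv that)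
    from DERIV_add[OF DERIV_const this] show ?thesis by (simp add: delta_lact)
  qed
  have "solves_linear (\<lambda>t. delta (G t)) a b boundary"
    unfolding boundary_def
    by (intro linear_solution_solves continuous_on_delta G_continuous delta_Nil)
  note boundary = solves_linearD[OF this]
  have "boundary a w = one0 w + delta (solution a) w"
    using delta_scale[of 0 "\<lambda>e. 0" w]
    by (simp add: boundary_def linear_solution_start solution_start)
  from has_real_derivative_eq_imp_eq[OF boundary solution this t]
  show "boundary t w = one0 w + delta (solution t) w" .
qed

lemma solution_solves: "solves_surface G a b solution"
  unfolding solves_surface_def
proof (intro ballI allI)
  fix t e assume "t \<in> {a..b}"
  from solution_deriv[OF this, of e]
  show "((\<lambda>t. solution t e) has_real_derivative G t e + mul1 (solution t) (G t) e)
      (at t within {a..b})"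
    by (simp only: boundary_eq[OF \<open>t \<in> {a..b}\<close>] lact_one_plus_delta)
qed

lemma uniformly_rapid_integrand: "T1.uniformly_rapid d {a..b} (\<lambda>t. lact (boundary t) (G t))"
  unfolding boundary_def
  by (intro uniformly_rapid_lact G_rapid uniformly_rapid_linear_solution_one0 uniformly_rapid_delta
      continuous_on_delta G_continuous)

lemma uniformly_rapid_solution: "T1.uniformly_rapid d {a..b} solution"
  unfolding solution_def[abs_def]
proof (rule T1.uniformly_rapid_integral[where L = "b - a"])
  show "T1.uniformly_rapid d (SIGMA t:{a..b}. {a..t}) (\<lambda>(t, \<tau>). lact (boundary \<tau>) (G \<tau>))"
    unfolding case_prod_unfold
    by (rule T1.uniformly_rapid_compose[OF uniformly_rapid_integrand]) auto
  show "continuous_on {a..t} (\<lambda>\<tau>. lact (boundary \<tau>) (G \<tau>) e)" if "t \<in> {a..b}" for t e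
    using that by (auto intro: continuous_on_subset[OF integrand_continuous])
qed auto

end

section \<open>Curves along the tail path\<close>

definition along_tail :: "(real \<Rightarrow> real \<Rightarrow> 'a) \<Rightarrow> real \<Rightarrow> real \<Rightarrow> real \<Rightarrow> real \<Rightarrow> 'a" where
  "along_tail P sm tm s u = (if u \<le> s - sm then P (u + sm) tm else P s (u - (s - sm) + tm))"

lemma tail_path_eq: "tail_path X sm tm s t i = along_tail (\<lambda>s t. X i (s, t)) sm tm s"
  by (simp add: tail_path_def along_tail_def fun_eq_iff)

lemma along_tail_end: "t \<ge> tm \<Longrightarrow> along_tail P sm tm s (tail_len sm tm s t) = P s t"
  by (auto simp: along_tail_def tail_len_def)

lemma along_tail_start: "s \<ge> sm \<Longrightarrow> along_tail P sm tm s 0 = P sm tm"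
  by (auto simp: along_tail_def)

lemma has_vector_derivative_compose_shift:
  fixes f :: "real \<Rightarrow> 'a::real_normed_vector"
  assumes "(f has_vector_derivative D) (at (u + c) within T)" "(\<lambda>u. u + c) ` S \<subseteq> T"
  shows "((\<lambda>u. f (u + c)) has_vector_derivative D) (at u within S)"
proof -
  have "((f \<circ> (\<lambda>u. u + c)) has_vector_derivative 1 *\<^sub>R D) (at u within S)"
  proof (rule vector_diff_chain_within)
    show "((\<lambda>u. u + c) has_vector_derivative 1) (at u within S)"
      by (auto intro!: derivative_eq_intros)
    show "(f has_vector_derivative D) (at (u + c) within (\<lambda>u. u + c) ` S)"
      by (rule has_vector_derivative_within_subset[OF assms])
  qed
  then show ?thesis by (simp add: o_def)
qed

locale tail_curve =
  fixes P :: "real \<Rightarrow> real \<Rightarrow> 'a::real_normed_vector" and DS DT :: "real \<Rightarrow> 'a"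
    and sm sp tm tp s t :: real
  assumes s: "s \<in> {sm..sp}" and t: "t \<in> {tm..tp}"
    and DS: "\<sigma> \<in> {sm..sp} \<Longrightarrow> ((\<lambda>\<sigma>. P \<sigma> tm) has_vector_derivative DS \<sigma>) (at \<sigma> within {sm..sp})"
    and DT: "\<tau> \<in> {tm..tp} \<Longrightarrow> ((\<lambda>\<tau>. P s \<tau>) has_vector_derivative DT \<tau>) (at \<tau> within {tm..tp})"
begin

lemma along_tail_continuous: "continuous_on {0..tail_len sm tm s t} (along_tail P sm tm s)"
proof -
  have S: "continuous_on {sm..sp} (\<lambda>\<sigma>. P \<sigma> tm)" and T: "continuous_on {tm..tp} (\<lambda>\<tau>. P s \<tau>)"
    using DS DT has_vector_derivative_continuous unfolding continuous_on_eq_continuous_within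
    by blast+
  show ?thesis
    unfolding along_tail_def
  proof (rule continuous_on_cases_le)
    show "continuous_on {u \<in> {0..tail_len sm tm s t}. u \<le> s - sm} (\<lambda>u. P (u + sm) tm)"
      by (rule continuous_on_compose2[OF S]) (use s in \<open>auto intro!: continuous_intros\<close>)
    show "continuous_on {u \<in> {0..tail_len sm tm s t}. s - sm \<le> u} (\<lambda>u. P s (u - (s - sm) + tm))"
      by (rule continuous_on_compose2[OF T])
        (use s t in \<open>auto simp: tail_len_def intro!: continuous_intros\<close>)
  qed auto
qed

lemma along_tail_deriv:
  assumes u: "u \<in> {0..tail_len sm tm s t}" "u \<noteq> s - sm"
  shows "(along_tail P sm tm s has_vector_derivative
    (if u \<le> s - sm then DS (u + sm) else DT (u - (s - sm) + tm)))
    (at u within {0..tail_len sm tm s t})"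
proof (cases "u < s - sm")
  case True
  have "((\<lambda>u. P (u + sm) tm) has_vector_derivative DS (u + sm)) (at u within {0..s - sm})"
    by (rule has_vector_derivative_compose_shift[OF DS]) (use u True s in auto)
  also have "at u within {0..s - sm} = at u within {0..tail_len sm tm s t}"
    by (rule at_within_nhd[of u "{..<s - sm}"]) (use True t in \<open>auto simp: tail_len_def\<close>)
  finally have "(along_tail P sm tm s has_vector_derivative DS (u + sm))
      (at u within {0..tail_len sm tm s t})"
    by (rule has_vector_derivative_transform_within[where d = "s - sm - u"])
      (use True u in \<open>auto simp: along_tail_def dist_real_def\<close>)
  then show ?thesis using True by simp
next
  case False
  with u have after: "s - sm < u" by simp
  have "((\<lambda>u. P s (u + (tm - (s - sm)))) has_vector_derivative DT (u + (tm - (s - sm))))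
      (at u within {s - sm..tail_len sm tm s t})"
    by (rule has_vector_derivative_compose_shift[OF DT])
      (use u after s t in \<open>auto simp: tail_len_def\<close>)
  also have "at u within {s - sm..tail_len sm tm s t} = at u within {0..tail_len sm tm s t}"
    by (rule at_within_nhd[of u "{s - sm<..}"]) (use after s in auto)
  finally have "(along_tail P sm tm s has_vector_derivative DT (u + (tm - (s - sm))))
      (at u within {0..tail_len sm tm s t})"
    by (rule has_vector_derivative_transform_within[where d = "u - (s - sm)"])
      (use after u in \<open>auto simp: along_tail_def dist_real_def algebra_simps\<close>)
  then show ?thesis using after by (simp add: algebra_simps)
qed

end

section \<open>Uniqueness of parallel transport, surface signature and surface holonomy\<close>

lemma sigr_eqI:
  fixes Y :: "nat list \<Rightarrow> real \<Rightarrow> real"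
  assumes "finite S" and Nil: "\<And>u. u \<in> {0..L} \<Longrightarrow> Y [] u = 1"
    and outside: "\<And>i w u. \<not> i < d \<Longrightarrow> u \<in> {0..L} \<Longrightarrow> Y (i # w) u = 0"
    and start: "\<And>i w. Y (i # w) 0 = 0" and cont: "\<And>w. continuous_on {0..L} (Y w)"
    and deriv: "\<And>i w u. i < d \<Longrightarrow> u \<in> {0..L} - S \<Longrightarrow>
      (Y (i # w) has_vector_derivative Y w u * vector_derivative (x i) (at u within {0..L}))
        (at u within {0..L})"
    and "u \<in> {0..L}"
  shows "sigr d L x u w = Y w u"
  using assms(7)
proof (induction w arbitrary: u)
  case (Cons i w)
  let ?x' = "\<lambda>u. vector_derivative (x i) (at u within {0..L})"
  show ?case
  proof (cases "i < d")
    case True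
    have "((\<lambda>v. Y w v * ?x' v) has_integral Y (i # w) u - Y (i # w) 0) {0..u}"
    proof (rule fundamental_theorem_of_calculus_interior_strong[OF \<open>finite S\<close>])
      show "continuous_on {0..u} (Y (i # w))"
        using Cons.prems by (intro continuous_on_subset[OF cont]) auto
      show "(Y (i # w) has_vector_derivative Y w v * ?x' v) (at v)" if "v \<in> {0<..<u} - S" for v
        using deriv[OF True, of v w] that Cons.prems by (simp add: at_within_Icc_at)
    qed (use Cons.prems in auto)
    then have "integral {0..u} (\<lambda>v. Y w v * ?x' v) = Y (i # w) u"
      by (simp add: integral_unique start)
    moreover have "integral {0..u} (\<lambda>v. sigr d L x v w * ?x' v)
        = integral {0..u} (\<lambda>v. Y w v * ?x' v)"
      using Cons by (intro integral_cong) auto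
    ultimately show ?thesis using True by simp
  qed (use outside Cons.prems in simp)
qed (simp add: Nil)

lemma ptrans_eqI:
  fixes F :: "real \<Rightarrow> 'a::{real_normed_algebra,real_algebra_1,banach}"
  assumes "0 \<le> L" "finite S" and start: "F 0 = 1" and cont: "continuous_on {0..L} F"
    and deriv: "\<And>u. u \<in> {0..L} - S \<Longrightarrow> (F has_vector_derivative F u * A u) (at u within {0..L})"
    and velocity: "\<And>u. u \<in> {0..L} - S \<Longrightarrow>
      (\<Sum>i<d. vector_derivative (x i) (at u within {0..L}) *\<^sub>R alp i) = A u"
    and bound: "\<And>u. u \<in> {0..L} - S \<Longrightarrow> norm (A u) \<le> C"
  shows "ptrans d alp L x = F L"
  unfolding ptrans_def
proof (rule the_equality)
  show "\<exists>G. G 0 = 1 \<and> G L = F L \<and> continuous_on {0..L} G \<and> (\<exists>S. finite S \<and> (\<forall>u\<in>{0..L} - S.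
      (G has_vector_derivative G u * (\<Sum>i<d. vector_derivative (x i) (at u within {0..L}) *\<^sub>R alp i))
        (at u within {0..L})))"
    using deriv velocity by (intro exI[of _ F] conjI start cont exI[of _ S] \<open>finite S\<close>) auto
next
  fix y assume "\<exists>G. G 0 = 1 \<and> G L = y \<and> continuous_on {0..L} G \<and> (\<exists>S. finite S \<and> (\<forall>u\<in>{0..L} - S.
      (G has_vector_derivative G u * (\<Sum>i<d. vector_derivative (x i) (at u within {0..L}) *\<^sub>R alp i))
        (at u within {0..L})))"
  then obtain G S' where G: "G 0 = 1" "G L = y" "continuous_on {0..L} G" "finite S'"
      and G_deriv: "\<And>u. u \<in> {0..L} - S' \<Longrightarrow>
        (G has_vector_derivative
          G u * (\<Sum>i<d. vector_derivative (x i) (at u within {0..L}) *\<^sub>R alp i))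
            (at u within {0..L})"
      by blast
  have "G L - F L = 0"
  proof (rule norm_derivative_le_imp_zero[where D = "\<lambda>u. G u - F u" and S = "S \<union> S'"])
    show "continuous_on {0..L} (\<lambda>u. G u - F u)" by (intro continuous_on_diff G cont)
    fix u assume u: "u \<in> {0..L} - (S \<union> S')"
    then show "((\<lambda>u. G u - F u) has_vector_derivative (G u - F u) * A u) (at u within {0..L})"
      unfolding left_diff_distrib using G_deriv[of u]
      by (intro has_vector_derivative_diff deriv) (auto simp: velocity)
    show "norm ((G u - F u) * A u) \<le> C * norm (G u - F u)"
      using order_trans[OF norm_mult_ineq mult_left_mono[OF bound]] u by (simp add: mult.commute)
  qed (use G \<open>finite S\<close> \<open>0 \<le> L\<close> start in auto)
  then show "y = F L" using G(2) by simp
qed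

definition signature_density ::
    "nat \<Rightarrow> real \<Rightarrow> real \<Rightarrow> (nat \<Rightarrow> real \<times> real \<Rightarrow> real) \<Rightarrow> real \<Rightarrow> real \<Rightarrow> t1" where
  "signature_density d sm tm X s t = (let g = sig d (tail_len sm tm s t) (tail_path X sm tm s t)
     in ract (lact g (Jt1 d X (s, t))) (inv0 g))"

definition holonomy_density ::
    "nat \<Rightarrow> (nat \<Rightarrow> 'a::{real_normed_algebra,real_algebra_1,banach})
      \<Rightarrow> (nat \<Rightarrow> nat \<Rightarrow> 'b::{real_normed_algebra,banach}) \<Rightarrow> ('a \<Rightarrow> 'b \<Rightarrow> 'b) \<Rightarrow> ('b \<Rightarrow> 'a \<Rightarrow> 'b)
      \<Rightarrow> real \<Rightarrow> real \<Rightarrow> (nat \<Rightarrow> real \<times> real \<Rightarrow> real) \<Rightarrow> real \<Rightarrow> real \<Rightarrow> 'b" where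
  "holonomy_density d alp gam l r sm tm X s t =
     (let F = ptrans d alp (tail_len sm tm s t) (tail_path X sm tm s t)
      in r (l F (\<Sum>i<d. \<Sum>j<d. if i < j then Jco X i j (s, t) *\<^sub>R gam i j else 0)) (ainv F))"

lemma umul1_driver: "umul1 x (0, F) = (0, \<lambda>b. fst x * F b + mul1 (snd x) F b)"
  by (cases x) (simp add: umul1_def)

lemma Rhat_eqI:
  assumes "tm \<le> tp" "Q tm = (\<lambda>b. 0)"
    and Q: "solves_surface (\<lambda>t b. integral {sm..sp} (\<lambda>s. signature_density d sm tm X s t b)) tm tp Q"
  shows "Rhat d sm sp tm tp X = (1, Q tp)"
proof -
  define G where "G = (\<lambda>t b. integral {sm..sp} (\<lambda>s. signature_density d sm tm X s t b))"
  define sol where "sol R \<longleftrightarrow> (\<forall>t\<in>{tm..tp}.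
     ((\<lambda>t. fst (R t)) has_real_derivative fst (umul1 (R t) (0, G t))) (at t within {tm..tp}) \<and>
     (\<forall>b. ((\<lambda>t. snd (R t) b) has_real_derivative snd (umul1 (R t) (0, G t)) b)
       (at t within {tm..tp})))" for R
  have "(THE y. \<exists>R. R tm = (1, \<lambda>b. 0) \<and> R tp = y \<and> sol R) = (1, Q tp)"
  proof (rule the_equality)
    have "sol (\<lambda>t. (1, Q t))"
      using Q unfolding sol_def solves_surface_def G_def umul1_driver by simp
    then show "\<exists>R. R tm = (1, \<lambda>b. 0) \<and> R tp = (1, Q tp) \<and> sol R"
      using assms(2) by (intro exI[of _ "\<lambda>t. (1, Q t)"]) simp
  next
    fix y assume "\<exists>R. R tm = (1, \<lambda>b. 0) \<and> R tp = y \<and> sol R"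
    then obtain R where R: "R tm = (1, \<lambda>b. 0)" "R tp = y" "sol R" by blast
    have unit: "fst (R t) = 1" if "t \<in> {tm..tp}" for t
      by (rule has_real_derivative_eq_imp_eq[where f' = "\<lambda>t. 0", OF _ DERIV_const _ that])
        (use R in \<open>auto simp: sol_def umul1_driver\<close>)
    have "solves_surface G tm tp (\<lambda>t. snd (R t))"
      unfolding solves_surface_def
    proof (intro ballI allI)
      fix t b assume t: "t \<in> {tm..tp}"
      then have "((\<lambda>t. snd (R t) b) has_real_derivative snd (umul1 (R t) (0, G t)) b)
          (at t within {tm..tp})"
        using R(3) unfolding sol_def by blast
      then show "((\<lambda>t. snd (R t) b) has_real_derivative G t b + mul1 (snd (R t)) (G t) b)
          (at t within {tm..tp})"
        by (simp add: umul1_driver unit[OF t])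
    qed
    from solves_surface_unique[OF this Q[folded G_def]]
    show "y = (1, Q tp)" using unit[of tp] R assms(1,2) by (auto intro: prod_eqI)
  qed
  then show ?thesis
    unfolding Rhat_def sol_def G_def signature_density_def Let_def .
qed

lemma umul_driver: "umul x (0, F) = (0, fst x *\<^sub>R F + snd x * F)"
  by (cases x) (simp add: umul_def)

lemma umul_solution_unique:
  fixes H :: "real \<Rightarrow> real \<times> 'b::{real_normed_algebra,banach}"
  assumes "H a = (1, 0)"
    and H: "\<And>t. t \<in> {a..b} \<Longrightarrow> (H has_vector_derivative umul (H t) (0, G t)) (at t within {a..b})"
    and "Q a = 0"
    and Q: "\<And>t. t \<in> {a..b} \<Longrightarrow> (Q has_vector_derivative G t + Q t * G t) (at t within {a..b})"
    and "bounded (G ` {a..b})" and t: "t \<in> {a..b}"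
  shows "H t = (1, Q t)"
proof -
  obtain C where C: "\<And>t. t \<in> {a..b} \<Longrightarrow> norm (G t) \<le> C"
    using \<open>bounded (G ` {a..b})\<close> unfolding bounded_iff by blast
  have unit: "fst (H t) = 1" if "t \<in> {a..b}" for t
  proof (rule has_real_derivative_eq_imp_eq[where f' = "\<lambda>t. 0", OF _ DERIV_const _ that])
    fix t assume "t \<in> {a..b}"
    from bounded_linear.has_vector_derivative[OF bounded_linear_fst H[OF this]]
    show "((\<lambda>t. fst (H t)) has_real_derivative 0) (at t within {a..b})"
      by (simp add: umul_driver has_real_derivative_iff_has_vector_derivative)
  qed (simp add: assms(1))
  have deriv: "((\<lambda>t. snd (H t) - Q t) has_vector_derivative (snd (H t) - Q t) * G t)
      (at t within {a..b})"
    if "t \<in> {a..b}" for t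
    using has_vector_derivative_diff[OF
        bounded_linear.has_vector_derivative[OF bounded_linear_snd H[OF that]] Q[OF that]]
    by (simp add: umul_driver unit[OF that] left_diff_distrib)
  have "snd (H t) - Q t = 0"
  proof (rule norm_derivative_le_imp_zero[where D = "\<lambda>t. snd (H t) - Q t" and S = "{}"])
    show "continuous_on {a..b} (\<lambda>t. snd (H t) - Q t)"
      using deriv has_vector_derivative_continuous unfolding continuous_on_eq_continuous_within
      by blast
    show "norm ((snd (H t) - Q t) * G t) \<le> C * norm (snd (H t) - Q t)" if "t \<in> {a..b} - {}" for t
      using order_trans[OF norm_mult_ineq mult_left_mono[OF C]] that by (simp add: mult.commute)
  qed (use deriv assms t in auto)
  then show ?thesis using unit[OF t] by (simp add: prod_eq_iff)
qed

lemma Hhat_eqI: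
  fixes Q :: "real \<Rightarrow> 'b::{real_normed_algebra,banach}"
    and alp :: "nat \<Rightarrow> 'a::{real_normed_algebra,real_algebra_1,banach}"
    and d gam l r sm sp tm X
  defines "G \<equiv> \<lambda>t. integral {sm..sp} (\<lambda>s. holonomy_density d alp gam l r sm tm X s t)"
  assumes "tm \<le> tp" "Q tm = 0"
    and Q: "\<And>t. t \<in> {tm..tp} \<Longrightarrow> (Q has_vector_derivative G t + Q t * G t) (at t within {tm..tp})"
    and bounded: "bounded (G ` {tm..tp})"
  shows "Hhat d alp gam l r sm sp tm tp X = (1, Q tp)"
proof -
  have "(THE y. \<exists>H. H tm = (1, 0) \<and> H tp = y \<and>
      (\<forall>t\<in>{tm..tp}. (H has_vector_derivative umul (H t) (0, G t)) (at t within {tm..tp})))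
    = (1, Q tp)"
  proof (rule the_equality)
    have "((\<lambda>t. (1, Q t)) has_vector_derivative umul (1, Q t) (0, G t)) (at t within {tm..tp})"
      if "t \<in> {tm..tp}" for t
      using Q[OF that] by (auto simp: umul_driver intro!: has_vector_derivative_Pair)
    then show "\<exists>H. H tm = (1, 0) \<and> H tp = (1, Q tp) \<and>
        (\<forall>t\<in>{tm..tp}. (H has_vector_derivative umul (H t) (0, G t)) (at t within {tm..tp}))"
      using \<open>Q tm = 0\<close> by (intro exI[of _ "\<lambda>t. (1, Q t)"]) simp
  next
    fix y assume "\<exists>H. H tm = (1, 0) \<and> H tp = y \<and>
        (\<forall>t\<in>{tm..tp}. (H has_vector_derivative umul (H t) (0, G t)) (at t within {tm..tp}))"
    then obtain H where H: "H tm = (1, 0)" "H tp = y"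
        "\<And>t. t \<in> {tm..tp} \<Longrightarrow> (H has_vector_derivative umul (H t) (0, G t))
            (at t within {tm..tp})" by blast
    from umul_solution_unique[OF H(1,3) \<open>Q tm = 0\<close> Q bounded, of tp]
    show "y = (1, Q tp)" using H(2) \<open>tm \<le> tp\<close> by simp
  qed
  then show ?thesis
    unfolding Hhat_def G_def holonomy_density_def Let_def .
qed

section \<open>The signatures of a smooth surface\<close>

locale surface =
  fixes d :: nat and sm sp tm tp :: real and X :: "nat \<Rightarrow> real \<times> real \<Rightarrow> real"
  assumes s_le: "sm \<le> sp" and t_le: "tm \<le> tp" and smooth: "smooth_surface d sm sp tm tp X"
begin

abbreviation rect :: "(real \<times> real) set" where
  "rect \<equiv> {sm..sp} \<times> {tm..tp}"

abbreviation s_velocity :: "real \<Rightarrow> real \<Rightarrow> t0" where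
  "s_velocity s t \<equiv> of_vector d (\<lambda>i. dS X i (s, t))"

abbreviation t_velocity :: "real \<Rightarrow> real \<Rightarrow> t0" where
  "t_velocity s t \<equiv> of_vector d (\<lambda>i. dT X i (s, t))"

lemma
  assumes "i < d"
  shows continuous_on_dS: "continuous_on rect (dS X i)"
    and continuous_on_dT: "continuous_on rect (dT X i)"
    and X_has_derivative: "z \<in> rect \<Longrightarrow> (X i has_derivative frechet_derivative (X i) (at z)) (at z)"
proof -
  obtain U where U: "rect \<subseteq> U" "Ck (Suc 0) U (X i)"
    using smooth assms unfolding smooth_surface_def by blast
  show "continuous_on rect (dS X i)" "continuous_on rect (dT X i)"
    using U(2)
    by (auto intro!: continuous_on_subset[OF _ U(1)] simp: dS_def[abs_def] dT_def[abs_def])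
  show "(X i has_derivative frechet_derivative (X i) (at z)) (at z)" if "z \<in> rect" for z
    using U that by (auto simp: frechet_derivative_works[symmetric])
qed

lemma
  assumes "i < d" "(s, t) \<in> rect"
  shows X_partial_s: "((\<lambda>s. X i (s, t)) has_vector_derivative dS X i (s, t)) (at s within T)"
    and X_partial_t: "((\<lambda>t. X i (s, t)) has_vector_derivative dT X i (s, t)) (at t within T)"
proof -
  have chain: "((\<lambda>x. X i (\<gamma> x)) has_vector_derivative frechet_derivative (X i) (at (s, t)) v)
      (at x within T)"
    if "(\<gamma> has_vector_derivative v) (at x within T)" "\<gamma> x = (s, t)" for \<gamma> v x
    using vector_derivative_diff_chain_within[OF that(1) has_derivative_at_withinI]
      X_has_derivative[OF assms]
    by (simp add: o_def that(2))
  show "((\<lambda>s. X i (s, t)) has_vector_derivative dS X i (s, t)) (at s within T)"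
    unfolding dS_def by (intro chain has_vector_derivative_Pair derivative_intros refl)
  show "((\<lambda>t. X i (s, t)) has_vector_derivative dT X i (s, t)) (at t within T)"
    unfolding dT_def by (intro chain has_vector_derivative_Pair derivative_intros refl)
qed

lemma bounded_image_rect: "continuous_on rect f \<Longrightarrow> bounded (f ` rect)"
  by (intro compact_imp_bounded compact_continuous_image compact_Times) auto

lemma uniformly_rapid_s_velocity: "T0.uniformly_rapid d rect (\<lambda>(s, t). s_velocity s t)"
  and uniformly_rapid_t_velocity: "T0.uniformly_rapid d rect (\<lambda>(s, t). t_velocity s t)"
  unfolding case_prod_unfold prod.collapse
  by (intro uniformly_rapid_of_vector bounded_image_rect continuous_on_dS continuous_on_dT,
    assumption)+

lemma continuous_on_s_velocity: "continuous_on rect (\<lambda>z. s_velocity (fst z) (snd z) w)"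
  and continuous_on_t_velocity: "continuous_on rect (\<lambda>z. t_velocity (fst z) (snd z) w)"
  by (auto intro!: continuous_on_of_vector continuous_on_dS continuous_on_dT)

lemma continuous_on_horizontal:
  "continuous_on rect (\<lambda>z. f (fst z) (snd z)) \<Longrightarrow> t \<in> {tm..tp} \<Longrightarrow> continuous_on {sm..sp} (\<lambda>s. f s t)"
  by (rule continuous_on_compose2[of rect "\<lambda>z. f (fst z) (snd z)" _ "\<lambda>s. (s, t)", simplified])
    (auto intro!: continuous_intros)

lemma continuous_on_vertical:
  "continuous_on rect (\<lambda>z. f (fst z) (snd z)) \<Longrightarrow> s \<in> {sm..sp} \<Longrightarrow> continuous_on {tm..tp} (\<lambda>t. f s t)"
  by (rule continuous_on_compose2[of rect "\<lambda>z. f (fst z) (snd z)" _ "\<lambda>t. (s, t)", simplified])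
    (auto intro!: continuous_intros)

subsection \<open>The signature of the tail path\<close>

definition bottom_sig :: "real \<Rightarrow> t0" where
  "bottom_sig = linear_solution (\<lambda>\<sigma>. s_velocity \<sigma> tm) sm one0"

definition tail_sig :: "real \<Rightarrow> real \<Rightarrow> t0" where
  "tail_sig s = linear_solution (t_velocity s) tm (bottom_sig s)"

lemma tail_sig_bottom: "tail_sig s tm = bottom_sig s"
  by (simp add: tail_sig_def linear_solution_start)

lemma tail_sig_start: "tail_sig sm tm = one0"
  by (simp add: tail_sig_bottom bottom_sig_def linear_solution_start)

lemma tail_sig_Nil: "tail_sig s t [] = 1"
  unfolding tail_sig_def bottom_sig_def
  by (subst linear_solution.simps, subst linear_solution.simps) (simp add: one0_def)

lemma bottom_sig_solves: "solves_linear (\<lambda>\<sigma>. s_velocity \<sigma> tm) sm sp bottom_sig"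
  unfolding bottom_sig_def using t_le
  by (intro linear_solution_solves continuous_on_horizontal[OF continuous_on_s_velocity]
    of_vector_Nil) simp

lemma tail_sig_solves_s: "solves_linear (\<lambda>\<sigma>. s_velocity \<sigma> tm) sm sp (\<lambda>\<sigma>. tail_sig \<sigma> tm)"
  unfolding tail_sig_bottom by (rule bottom_sig_solves)

lemma tail_sig_solves_t: "s \<in> {sm..sp} \<Longrightarrow> solves_linear (t_velocity s) tm tp (tail_sig s)"
  unfolding tail_sig_def
  by (intro linear_solution_solves continuous_on_vertical[OF continuous_on_t_velocity] of_vector_Nil)

lemma continuous_on_tail_sig: "continuous_on rect (\<lambda>z. tail_sig (fst z) (snd z) w)"
  unfolding tail_sig_def
  by (intro continuous_on_linear_solution_param solves_linear_continuous[OF bottom_sig_solves]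
      continuous_on_t_velocity)

lemma uniformly_rapid_tail_sig: "T0.uniformly_rapid d rect (\<lambda>(s, t). tail_sig s t)"
  unfolding tail_sig_def
proof (rule uniformly_rapid_linear_solution[OF _ uniformly_rapid_t_velocity])
  have "T0.uniformly_rapid d {sm..sp} (\<lambda>\<sigma>. s_velocity \<sigma> tm)"
    using T0.uniformly_rapid_compose[OF uniformly_rapid_s_velocity,
        of "{sm..sp}" "\<lambda>\<sigma>. (\<sigma>, tm)"] t_le by simp
  then show "T0.uniformly_rapid d {sm..sp} bottom_sig"
    unfolding bottom_sig_def using t_le
    by (intro uniformly_rapid_linear_solution_one0
      continuous_on_horizontal[OF continuous_on_s_velocity]) simp_all
qed (intro continuous_on_vertical[OF continuous_on_t_velocity])

lemma mul0_tail_sig_antipode: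
  assumes "s \<in> {sm..sp}" "t \<in> {tm..tp}"
  shows "mul0 (tail_sig s t) (antipode (tail_sig s t)) = one0"
proof (rule mul0_antipode_eq_one0[OF tail_sig_solves_t[OF assms(1)] _ assms(2)])
  show "mul0 (tail_sig s tm) (antipode (tail_sig s tm)) = one0"
    by (rule mul0_antipode_eq_one0[OF tail_sig_solves_s _ assms(1)])
      (simp add: tail_sig_start antipode_one0 mul0_one_left)
qed

lemma tail_path_deriv:
  assumes "i < d" "s \<in> {sm..sp}" "t \<in> {tm..tp}" "u \<in> {0..tail_len sm tm s t}" "u \<noteq> s - sm"
  shows "vector_derivative (tail_path X sm tm s t i) (at u within {0..tail_len sm tm s t})
     = (if u \<le> s - sm then dS X i (u + sm, tm) else dT X i (s, u - (s - sm) + tm))"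
proof -
  interpret tail_curve "\<lambda>s t. X i (s, t)" "\<lambda>\<sigma>. dS X i (\<sigma>, tm)" "\<lambda>\<tau>. dT X i (s, \<tau>)" sm sp tm tp s t
    by standard (use assms t_le in \<open>auto intro!: X_partial_s X_partial_t\<close>)
  have "0 < tail_len sm tm s t" using assms by (auto simp: tail_len_def)
  then show ?thesis
    unfolding tail_path_eq using assms(4,5)
    by (intro vector_derivative_within_closed_interval along_tail_deriv)
qed

lemma sig_tail:
  assumes st: "s \<in> {sm..sp}" "t \<in> {tm..tp}"
  shows "sig d (tail_len sm tm s t) (tail_path X sm tm s t) = tail_sig s t"
proof
  fix w
  let ?L = "tail_len sm tm s t"
  let ?Y = "\<lambda>w. along_tail (\<lambda>s t. tail_sig s t (rev w)) sm tm s"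
  have curve: "tail_curve (\<lambda>s t. tail_sig s t w)
      (\<lambda>\<sigma>. mul0 (tail_sig \<sigma> tm) (s_velocity \<sigma> tm) w)
      (\<lambda>\<tau>. mul0 (tail_sig s \<tau>) (t_velocity s \<tau>) w) sm sp tm tp s t" for w
    using solves_linearD[OF tail_sig_solves_s] solves_linearD[OF tail_sig_solves_t[OF st(1)]] st
    by unfold_locales (simp_all add: has_real_derivative_iff_has_vector_derivative)
  have "sigr d ?L (tail_path X sm tm s t) ?L (rev w) = ?Y (rev w) ?L"
  proof (rule sigr_eqI[where S = "{s - sm}"])
    fix i w u
    show "?Y [] u = 1" by (simp add: along_tail_def tail_sig_Nil)
    show "?Y (i # w) 0 = 0" using st by (simp add: along_tail_start tail_sig_start one0_def)
    show "continuous_on {0..?L} (?Y w)" by (rule tail_curve.along_tail_continuous[OF curve])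
    show "?Y (i # w) u = 0" if "\<not> i < d" "u \<in> {0..?L}"
    proof -
      have "\<not> valid0 d (rev (i # w))" using that by (simp add: valid0_def)
      then have "tail_sig s t (rev (i # w)) = 0" if "(s, t) \<in> rect" for s t
        using T0.uniformly_rapid_support[OF uniformly_rapid_tail_sig that] by simp
      then show ?thesis using that st t_le by (auto simp: along_tail_def tail_len_def)
    qed
    assume i: "i < d" and u: "u \<in> {0..?L} - {s - sm}"
    then have "u \<in> {0..?L}" "u \<noteq> s - sm" by auto
    with tail_curve.along_tail_deriv[OF curve this, of "rev (i # w)"] i
    show "(?Y (i # w) has_vector_derivative
        ?Y w u * vector_derivative (tail_path X sm tm s t i) (at u within {0..?L}))
        (at u within {0..?L})"
      unfolding tail_path_deriv[OF i st \<open>u \<in> {0..?L}\<close> \<open>u \<noteq> s - sm\<close>]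
      by (simp add: mul0_of_vector_snoc along_tail_def split: if_splits)
  qed (use st in \<open>auto simp: tail_len_def\<close>)
  then show "sig d ?L (tail_path X sm tm s t) w = tail_sig s t w"
    using st by (simp add: sig_def along_tail_end)
qed

subsection \<open>The surface signature\<close>

lemma signature_density_eq:
  assumes "s \<in> {sm..sp}" "t \<in> {tm..tp}"
  shows "signature_density d sm tm X s t
    = ract (lact (tail_sig s t) (Jt1 d X (s, t))) (antipode (tail_sig s t))"
  using inv0_eq[OF mul0_tail_sig_antipode[OF assms]]
  by (simp add: signature_density_def sig_tail[OF assms] Let_def)

lemma continuous_on_Jt1: "continuous_on rect (\<lambda>z. Jt1 d X z b)"
proof -
  obtain u i j v where b: "b = (u, (i, j), v)" by (cases b) auto
  show ?thesis
  proof (cases "u = [] \<and> v = [] \<and> i < j \<and> j < d")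
    case True
    then have "continuous_on rect (Jco X i j)"
      unfolding Jco_def[abs_def] by (intro continuous_intros continuous_on_dS continuous_on_dT) auto
    then show ?thesis using True by (simp add: Jt1_def b)
  next
    case False
    then have "Jt1 d X z b = 0" for z unfolding Jt1_def b prod.case by (rule if_not_P)
    then show ?thesis by simp
  qed
qed

lemma uniformly_rapid_Jt1: "T1.uniformly_rapid d rect (Jt1 d X)"
proof (rule T1.uniformly_rapid_finite_support[OF finite_valid1_level[of d 2]])
  fix z and b :: tb assume "b \<notin> {b. valid1 d b \<and> level1 b = 2}"
  moreover obtain u i j v where "b = (u, (i, j), v)" by (cases b) auto
  ultimately show "Jt1 d X z b = 0" by (auto simp: Jt1_def valid1_iff valid0_def level1_def)
qed (simp_all add: bounded_image_rect continuous_on_Jt1)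

lemma continuous_on_signature_density:
  "continuous_on rect (\<lambda>z. signature_density d sm tm X (fst z) (snd z) b)"
proof -
  have "continuous_on rect (\<lambda>z. ract (lact (tail_sig (fst z) (snd z)) (Jt1 d X (fst z, snd z)))
      (antipode (tail_sig (fst z) (snd z))) b)"
    unfolding prod.collapse antipode_def[abs_def]
    by (intro continuous_on_ract continuous_on_lact continuous_intros continuous_on_tail_sig
      continuous_on_Jt1)
  then show ?thesis by (rule continuous_on_eq) (auto simp: signature_density_eq)
qed

lemma uniformly_rapid_signature_density:
  "T1.uniformly_rapid d rect (\<lambda>(s, t). signature_density d sm tm X s t)"
proof -
  note rapid = uniformly_rapid_tail_sig[unfolded case_prod_unfold]
  have "T1.uniformly_rapid d rect
      (\<lambda>z. ract (lact (tail_sig (fst z) (snd z)) (Jt1 d X z)) (antipode (tail_sig (fst z) (snd z))))"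
    by (intro uniformly_rapid_ract uniformly_rapid_lact uniformly_rapid_antipode rapid
      uniformly_rapid_Jt1)
  then show ?thesis
    by (rule T1.uniformly_rapid_cong[THEN iffD1, rotated]) (auto simp: signature_density_eq)
qed

definition surface_driver :: "real \<Rightarrow> t1" where
  "surface_driver t b = integral {sm..sp} (\<lambda>s. signature_density d sm tm X s t b)"

sublocale signature: surface_equation d tm tp surface_driver
proof
  have "T1.uniformly_rapid d (SIGMA t:{tm..tp}. {sm..sp}) (\<lambda>(t, s). signature_density d sm tm X s t)"
    using T1.uniformly_rapid_compose[OF uniformly_rapid_signature_density,
        of "{tm..tp} \<times> {sm..sp}" prod.swap]
    by (force simp: case_prod_unfold)
  then show "T1.uniformly_rapid d {tm..tp} surface_driver"
    unfolding surface_driver_def[abs_def]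
    by (rule T1.uniformly_rapid_integral[where L = "sp - sm"])
      (use s_le in \<open>auto intro: continuous_on_horizontal[OF continuous_on_signature_density]\<close>)
  show "continuous_on {tm..tp} (\<lambda>t. surface_driver t b)" for b
  proof -
    have "continuous_on ({tm..tp} \<times> cbox sm sp) (\<lambda>(t, s). signature_density d sm tm X s t b)"
      unfolding case_prod_unfold
      by (rule continuous_on_compose2[OF continuous_on_signature_density,
            of _ prod.swap b, simplified])
        (auto intro!: continuous_on_swap)
    from integral_continuous_on_param[OF this] show ?thesis by (simp add: surface_driver_def)
  qed
qed

theorem Rhat_eq: "Rhat d sm sp tm tp X = (1, signature.solution tp)"
  using signature.solution_solves
  by (intro Rhat_eqI t_le signature.solution_start) (simp add: surface_driver_def[abs_def])

end

section \<open>Continuous morphisms out of the universal crossed module\<close>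

lemma zeta_eq_basis_vec: "zeta i = basis_vec [i]"
  by (auto simp: zeta_def basis_vec_def)

lemma one0_eq_basis_vec: "one0 = basis_vec []"
  by (auto simp: one0_def basis_vec_def)

lemma Zc_eq_basis_vec: "Zc i j = basis_vec ([], (i, j), [])"
  by (auto simp: Zc_def basis_vec_def)

locale xmod_morphism =
  fixes d :: nat
    and dA :: "'b::{real_normed_algebra,banach} \<Rightarrow> 'a::{real_normed_algebra,real_algebra_1,banach}"
    and l :: "'a \<Rightarrow> 'b \<Rightarrow> 'b" and r :: "'b \<Rightarrow> 'a \<Rightarrow> 'b"
    and alp :: "nat \<Rightarrow> 'a" and gam :: "nat \<Rightarrow> nat \<Rightarrow> 'b"
    and atl :: "t0 \<Rightarrow> 'a" and gt :: "t1 \<Rightarrow> 'b"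
  assumes xmod: "xmod_banach dA l r" and morphism: "ext_morphism d dA l r alp gam atl gt"
begin

lemma atl_mul0: "x \<in> T0.entire d \<Longrightarrow> y \<in> T0.entire d \<Longrightarrow> atl (mul0 x y) = atl x * atl y"
  using morphism by (simp add: ext_morphism_def E0_eq_entire)

lemma atl_one0: "atl one0 = 1"
  using morphism by (simp add: ext_morphism_def)

lemma atl_letter: "i < d \<Longrightarrow> atl (basis_vec [i]) = alp i"
  using morphism by (simp add: ext_morphism_def zeta_eq_basis_vec)

lemma gt_linear: "E \<in> T1.entire d \<Longrightarrow> F \<in> T1.entire d \<Longrightarrow> gt (\<lambda>b. c * E b + F b) = c *\<^sub>R gt E + gt F"
  using morphism by (simp add: ext_morphism_def E1_eq_entire)

lemma gt_mul1: "E \<in> T1.entire d \<Longrightarrow> F \<in> T1.entire d \<Longrightarrow> gt (mul1 E F) = gt E * gt F"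
  using morphism by (simp add: ext_morphism_def E1_eq_entire)

lemma gt_lact: "x \<in> T0.entire d \<Longrightarrow> E \<in> T1.entire d \<Longrightarrow> gt (lact x E) = l (atl x) (gt E)"
  and gt_ract: "x \<in> T0.entire d \<Longrightarrow> E \<in> T1.entire d \<Longrightarrow> gt (ract E x) = r (gt E) (atl x)"
  using morphism by (simp_all add: ext_morphism_def E0_eq_entire E1_eq_entire)

lemma gt_wedge: "i < j \<Longrightarrow> j < d \<Longrightarrow> gt (basis_vec ([], (i, j), [])) = gam i j"
  using morphism by (simp add: ext_morphism_def Zc_eq_basis_vec)

lemma norm_l_le: "norm (l x E) \<le> norm x * norm E" and norm_r_le: "norm (r E x) \<le> norm E * norm x"
  using xmod unfolding xmod_banach_def by blast+

definition letter_bound :: real where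
  "letter_bound = 1 + (\<Sum>i<d. norm (alp i))"

lemma letter_bound_ge_1: "1 \<le> letter_bound"
  by (simp add: letter_bound_def sum_nonneg)

lemma norm_alp_le: "i < d \<Longrightarrow> norm (alp i) \<le> letter_bound"
  using member_le_sum[of i "{..<d}" "\<lambda>i. norm (alp i)"] by (simp add: letter_bound_def)

lemma norm_atl_basis_vec_le:
  "valid0 d w \<Longrightarrow> norm (atl (basis_vec w)) \<le> norm (1::'a) * letter_bound ^ length w"
proof (induction w)
  case Nil
  then show ?case using atl_one0 by (simp add: one0_eq_basis_vec)
next
  case (Cons i w)
  then have i: "i < d" and w: "valid0 d w" by (auto simp: valid0_def)
  have "atl (basis_vec (i # w)) = atl (mul0 (basis_vec [i]) (basis_vec w))"
    by (simp add: mul0_basis_vec)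
  also have "\<dots> = alp i * atl (basis_vec w)"
    using i w by (simp add: atl_mul0 T0.basis_vec_entire atl_letter valid0_def)
  finally have "norm (atl (basis_vec (i # w))) \<le> norm (alp i) * norm (atl (basis_vec w))"
    by (simp add: norm_mult_ineq)
  also have "\<dots> \<le> letter_bound * (norm (1::'a) * letter_bound ^ length w)"
    by (rule mult_mono[OF norm_alp_le[OF i] Cons.IH[OF w]]) (use letter_bound_ge_1 in auto)
  finally show ?case by (simp add: mult_ac)
qed

definition wedge_bound :: real where
  "wedge_bound = (\<Sum>(i, j)\<in>{..<d} \<times> {..<d}. norm (gam i j))"

lemma wedge_bound_nonneg: "0 \<le> wedge_bound"
  by (auto simp: wedge_bound_def intro!: sum_nonneg)

lemma norm_gam_le: "i < d \<Longrightarrow> j < d \<Longrightarrow> norm (gam i j) \<le> wedge_bound"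
  using member_le_sum[of "(i, j)" "{..<d} \<times> {..<d}" "\<lambda>(i, j). norm (gam i j)"]
  by (auto simp: wedge_bound_def)

lemma gt_basis_vec:
  assumes "valid1 d (u, (i, j), v)"
  shows "gt (basis_vec (u, (i, j), v)) = r (l (atl (basis_vec u)) (gam i j)) (atl (basis_vec v))"
proof -
  have valid: "valid0 d u" "valid0 d v" "i < j" "j < d" using assms by (auto simp: valid1_iff)
  have entire: "basis_vec u \<in> T0.entire d" "basis_vec v \<in> T0.entire d"
      "basis_vec ([], (i, j), []) \<in> T1.entire d" "basis_vec (u, (i, j), []) \<in> T1.entire d"
    using valid by (auto intro!: T0.basis_vec_entire T1.basis_vec_entire simp: valid1_iff valid0_def)
  have "gt (basis_vec (u, (i, j), v)) = r (gt (basis_vec (u, (i, j), []))) (atl (basis_vec v))"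
    using gt_ract[OF entire(2,4)] by (simp add: ract_basis_vec)
  also have "gt (basis_vec (u, (i, j), [])) = l (atl (basis_vec u)) (gam i j)"
    using gt_lact[OF entire(1,3)] gt_wedge[OF valid(3,4)] by (simp add: lact_basis_vec)
  finally show ?thesis .
qed

lemma norm_gt_basis_vec_le:
  assumes "valid1 d b"
  shows "norm (gt (basis_vec b)) \<le> norm (1::'a) * wedge_bound * norm (1::'a)
      * letter_bound ^ level1 b"
proof -
  obtain u i j v where b: "b = (u, (i, j), v)" by (cases b) auto
  have valid: "valid0 d u" "valid0 d v" "i < d" "j < d" using assms by (auto simp: b valid1_iff)
  have "norm (gt (basis_vec b)) \<le> norm (l (atl (basis_vec u)) (gam i j)) * norm (atl (basis_vec v))"
    using assms norm_r_le by (simp add: b gt_basis_vec)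
  also have "\<dots> \<le> (norm (atl (basis_vec u)) * norm (gam i j)) * norm (atl (basis_vec v))"
    by (intro mult_right_mono norm_l_le) simp
  also have "\<dots> \<le> ((norm (1::'a) * letter_bound ^ length u) * wedge_bound)
      * (norm (1::'a) * letter_bound ^ length v)"
    using letter_bound_ge_1 wedge_bound_nonneg
    by (intro mult_mono norm_atl_basis_vec_le norm_gam_le valid) auto
  also have "\<dots> = norm (1::'a) * wedge_bound * norm (1::'a) * letter_bound ^ (length u + length v)"
    by (simp add: power_add mult_ac)
  also have "\<dots> \<le> norm (1::'a) * wedge_bound * norm (1::'a) * letter_bound ^ level1 b"
    using letter_bound_ge_1 wedge_bound_nonneg
    by (intro mult_left_mono power_increasing) (auto simp: b level1_def)
  finally show ?thesis .
qed

sublocale A0: graded_functional "valid0 d" length "Suc d" "norm0 d" atl "norm (1::'a)" letter_bound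
  using morphism letter_bound_ge_1
  by unfold_locales
    (auto simp: ext_morphism_def E0_eq_entire top0_eq_entire_topology norm_atl_basis_vec_le)

sublocale A1: graded_functional "valid1 d" level1 "2 * Suc d" "norm1 d" gt
    "norm (1::'a) * wedge_bound * norm (1::'a)" letter_bound
proof
  show "continuous_map (T1.entire_topology d) euclidean gt"
    using morphism by (simp add: ext_morphism_def top1_eq_entire_topology)
qed (use gt_linear norm_gt_basis_vec_le letter_bound_ge_1 wedge_bound_nonneg in auto)

lemma atl_of_vector: "atl (of_vector d v) = (\<Sum>i<d. v i *\<^sub>R alp i)"
proof -
  have "atl (of_vector d v) = (\<Sum>w\<in>(\<lambda>i. [i]) ` {..<d}. v (hd w) *\<^sub>R atl (basis_vec w))"
    unfolding of_vector_eq by (rule A0.f_finite_support) (auto simp: valid0_def)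
  also have "\<dots> = (\<Sum>i<d. v i *\<^sub>R alp i)"
    by (subst sum.reindex) (auto simp: inj_on_def atl_letter)
  finally show ?thesis .
qed

lemma gt_Jt1: "gt (Jt1 d X z) = (\<Sum>i<d. \<Sum>j<d. if i < j then Jco X i j z *\<^sub>R gam i j else 0)"
proof -
  let ?P = "{p \<in> {..<d} \<times> {..<d}. fst p < snd p}"
  let ?I = "(\<lambda>p. ([], p, [])) ` ?P :: tb set"
  have "Jt1 d X z = (\<lambda>b. if b \<in> ?I then Jt1 d X z b else 0)"
    by (auto simp: Jt1_def fun_eq_iff image_iff)
  then have "gt (Jt1 d X z) = gt (\<lambda>b. if b \<in> ?I then Jt1 d X z b else 0)" by (rule arg_cong)
  also have "\<dots> = (\<Sum>b\<in>?I. Jt1 d X z b *\<^sub>R gt (basis_vec b))"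
    by (rule A1.f_finite_support) (auto simp: valid1_def)
  also have "\<dots> = (\<Sum>p\<in>?P. Jco X (fst p) (snd p) z *\<^sub>R gam (fst p) (snd p))"
    by (subst sum.reindex) (auto simp: inj_on_def gt_wedge Jt1_def intro!: sum.cong)
  also have "\<dots> = (\<Sum>p\<in>{..<d} \<times> {..<d}.
      if fst p < snd p then Jco X (fst p) (snd p) z *\<^sub>R gam (fst p) (snd p) else 0)"
    by (rule sum.inter_filter) simp
  also have "\<dots> = (\<Sum>i<d. \<Sum>j<d. if i < j then Jco X i j z *\<^sub>R gam i j else 0)"
    unfolding sum.cartesian_product by (simp add: case_prod_unfold)
  finally show ?thesis .
qed

lemma atl_solves_linear:
  assumes Y: "solves_linear H a b Y"
    and rapid: "T0.uniformly_rapid d {a..b} Y" "T0.uniformly_rapid d {a..b} H"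
    and t: "t \<in> {a..b}"
  shows "((\<lambda>t. atl (Y t)) has_vector_derivative atl (Y t) * atl (H t)) (at t within {a..b})"
proof -
  have "((\<lambda>t. atl (Y t)) has_vector_derivative atl (mul0 (Y t) (H t))) (at t within {a..b})"
    by (intro A0.has_vector_derivative_image t uniformly_rapid_mul0 rapid solves_linearD[OF Y]) simp
  also have "atl (mul0 (Y t) (H t)) = atl (Y t) * atl (H t)"
    by (intro atl_mul0 T0.uniformly_rapid_entire[OF _ t] rapid)
  finally show ?thesis .
qed

lemma ainv_atl:
  assumes "x \<in> T0.entire d" "y \<in> T0.entire d" "mul0 x y = one0"
  shows "ainv (atl x) = atl y"
  unfolding ainv_def
proof (rule the_equality)
  show inverse: "atl x * atl y = 1 \<and> atl y * atl x = 1"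
    using assms mul0_inverse_commute[OF assms(3)] by (metis atl_mul0 atl_one0)
  fix c assume "atl x * c = 1 \<and> c * atl x = 1"
  then show "c = atl y" using inverse by (metis mult.assoc mult.left_neutral mult.right_neutral)
qed

lemma gt_surface_solution:
  assumes "surface_equation d a b G" "t \<in> {a..b}"
  defines "R \<equiv> surface_equation.solution a G"
  shows "((\<lambda>t. gt (R t)) has_vector_derivative gt (G t) + gt (R t) * gt (G t)) (at t within {a..b})"
proof -
  interpret surface_equation d a b G by fact
  have "((\<lambda>t. gt (solution t)) has_vector_derivative gt (lact (boundary t) (G t)))
      (at t within {a..b})"
    by (intro A1.has_vector_derivative_image assms(2) uniformly_rapid_solution
      uniformly_rapid_integrand solution_deriv) simp
  also have "lact (boundary t) (G t) = (\<lambda>e. G t e + mul1 (solution t) (G t) e)"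
    unfolding boundary_eq[OF assms(2)] by (rule ext) (rule lact_one_plus_delta)
  also have "gt \<dots> = gt (G t) + gt (solution t) * gt (G t)"
  proof -
    have "T1.uniformly_rapid d {a..b} (\<lambda>t. mul1 (solution t) (G t))"
      unfolding mul1_def
      by (intro uniformly_rapid_lact uniformly_rapid_delta uniformly_rapid_solution G_rapid)
    note entire = this G_rapid uniformly_rapid_solution
    then show ?thesis
      using entire[THEN T1.uniformly_rapid_entire, OF assms(2)]
        gt_linear[of "G t" "mul1 (solution t) (G t)" 1] by (simp add: gt_mul1)
  qed
  finally show ?thesis by (simp add: R_def)
qed

end

section \<open>Surface signature and surface holonomy\<close>

locale surface_morphism = surface d sm sp tm tp X + xmod_morphism d dA l r alp gam atl gt
  for d sm sp tm tp X
    and dA :: "'b::{real_normed_algebra,banach} \<Rightarrow> 'a::{real_normed_algebra,real_algebra_1,banach}"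
    and l r alp gam atl gt
begin

lemma ptrans_tail:
  assumes st: "s \<in> {sm..sp}" "t \<in> {tm..tp}"
  shows "ptrans d alp (tail_len sm tm s t) (tail_path X sm tm s t) = atl (tail_sig s t)"
proof -
  let ?L = "tail_len sm tm s t" and ?F = "along_tail (\<lambda>s t. atl (tail_sig s t)) sm tm s"
  define A where "A u = (if u \<le> s - sm then atl (s_velocity (u + sm) tm)
      else atl (t_velocity s (u - (s - sm) + tm)))" for u
  have tm: "tm \<in> {tm..tp}" using t_le by simp
  note on_s = T0.uniformly_rapid_compose[where \<phi> = "\<lambda>s. (s, tm)" and S = "{sm..sp}", simplified]
  note on_t = T0.uniformly_rapid_compose[where \<phi> = "\<lambda>t. (s, t)" and S = "{tm..tp}", simplified]
  interpret tail_curve "\<lambda>s t. atl (tail_sig s t)" "\<lambda>\<sigma>. atl (tail_sig \<sigma> tm) * atl (s_velocity \<sigma> tm)"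
    "\<lambda>\<tau>. atl (tail_sig s \<tau>) * atl (t_velocity s \<tau>)" sm sp tm tp s t
    using on_s[OF uniformly_rapid_tail_sig] on_s[OF uniformly_rapid_s_velocity]
      on_t[OF uniformly_rapid_tail_sig] on_t[OF uniformly_rapid_t_velocity] st tm
    by unfold_locales (auto intro!: atl_solves_linear tail_sig_solves_s tail_sig_solves_t)
  have "bounded ((\<lambda>z. atl (s_velocity (fst z) (snd z))) ` rect
      \<union> (\<lambda>z. atl (t_velocity (fst z) (snd z))) ` rect)"
    using uniformly_rapid_s_velocity[THEN A0.bounded_image]
      uniformly_rapid_t_velocity[THEN A0.bounded_image] by (simp add: case_prod_unfold)
  then obtain C where C: "norm (atl (s_velocity s t)) \<le> C" "norm (atl (t_velocity s t)) \<le> C"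
    if "(s, t) \<in> rect" for s t
    unfolding bounded_iff by fastforce
  have "ptrans d alp ?L (tail_path X sm tm s t) = ?F ?L"
  proof (rule ptrans_eqI[where S = "{s - sm}" and A = A])
    show "?F 0 = 1" using st by (simp add: along_tail_start tail_sig_start atl_one0)
    fix u assume u: "u \<in> {0..?L} - {s - sm}"
    then show "(?F has_vector_derivative ?F u * A u) (at u within {0..?L})"
      using along_tail_deriv[of u] by (auto simp: A_def along_tail_def split: if_splits)
    show "(\<Sum>i<d. vector_derivative (tail_path X sm tm s t i) (at u within {0..?L}) *\<^sub>R alp i) = A u"
      using tail_path_deriv[OF _ st] u by (auto simp: A_def atl_of_vector)
    show "norm (A u) \<le> C"
      using C(1)[of "u + sm" tm] C(2)[of s "u - (s - sm) + tm"] u st tm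
      by (auto simp: A_def tail_len_def)
  qed (use along_tail_continuous st in \<open>auto simp: tail_len_def\<close>)
  then show ?thesis using st by (simp add: along_tail_end)
qed

lemma gt_signature_density:
  assumes st: "s \<in> {sm..sp}" "t \<in> {tm..tp}"
  shows "gt (signature_density d sm tm X s t) = holonomy_density d alp gam l r sm tm X s t"
proof -
  have in_rect: "(s, t) \<in> rect" using st by simp
  have tail: "T0.uniformly_rapid d rect (\<lambda>z. tail_sig (fst z) (snd z))"
    using uniformly_rapid_tail_sig by (simp add: case_prod_unfold)
  have entire: "tail_sig s t \<in> T0.entire d" "antipode (tail_sig s t) \<in> T0.entire d"
    "Jt1 d X (s, t) \<in> T1.entire d" "lact (tail_sig s t) (Jt1 d X (s, t)) \<in> T1.entire d"
    using T0.uniformly_rapid_entire[OF tail in_rect]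
      T0.uniformly_rapid_entire[OF uniformly_rapid_antipode[OF tail] in_rect]
      T1.uniformly_rapid_entire[OF uniformly_rapid_Jt1 in_rect]
      T1.uniformly_rapid_entire[OF uniformly_rapid_lact[OF tail uniformly_rapid_Jt1] in_rect]
    by simp_all
  show ?thesis
    using ainv_atl[OF entire(1,2) mul0_tail_sig_antipode[OF st]] entire
    by (simp add: signature_density_eq[OF st] holonomy_density_def Let_def ptrans_tail[OF st] gt_Jt1
      gt_ract gt_lact)
qed

lemma gt_surface_driver:
  assumes t: "t \<in> {tm..tp}"
  shows "integral {sm..sp} (\<lambda>s. holonomy_density d alp gam l r sm tm X s t) = gt (surface_driver t)"
proof -
  have "T1.uniformly_rapid d {sm..sp} (\<lambda>s. signature_density d sm tm X s t)"
    using T1.uniformly_rapid_compose[OF uniformly_rapid_signature_density,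
        of "{sm..sp}" "\<lambda>s. (s, t)"] t by simp
  then have "((\<lambda>s. gt (signature_density d sm tm X s t))
      has_integral gt (surface_driver t)) {sm..sp}"
    unfolding surface_driver_def[abs_def]
    by (intro A1.has_integral_image s_le continuous_on_horizontal[OF continuous_on_signature_density]
      t)
  then have "((\<lambda>s. holonomy_density d alp gam l r sm tm X s t)
      has_integral gt (surface_driver t)) {sm..sp}"
    by (rule has_integral_eq[rotated]) (rule gt_signature_density[OF _ t])
  then show ?thesis by (rule integral_unique)
qed

theorem Hhat_eq: "Hhat d alp gam l r sm sp tm tp X = (1, gt (signature.solution tp))"
proof (rule Hhat_eqI[OF t_le])
  show "gt (signature.solution tm) = 0" by (simp add: signature.solution_start A1.f_zero)
  show "((\<lambda>t. gt (signature.solution t)) has_vector_derivative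
      integral {sm..sp} (\<lambda>s. holonomy_density d alp gam l r sm tm X s t) +
      gt (signature.solution t) * integral {sm..sp} (\<lambda>s. holonomy_density d alp gam l r sm tm X s t))
        (at t within {tm..tp})"
    if "t \<in> {tm..tp}" for t
    using gt_surface_solution[OF signature.surface_equation_axioms that]
    by (simp add: gt_surface_driver[OF that])
  show "bounded ((\<lambda>t. integral {sm..sp} (\<lambda>s. holonomy_density d alp gam l r sm tm X s t)) ` {tm..tp})"
    using A1.bounded_image[OF signature.G_rapid]
    by (simp add: gt_surface_driver cong: image_cong_simp)
qed

end

theorem theorem4p29:
  fixes d :: nat
    and dA :: "'b::{real_normed_algebra,banach} \<Rightarrow> 'a::{real_normed_algebra,real_algebra_1,banach}"
    and l :: "'a \<Rightarrow> 'b \<Rightarrow> 'b" and r :: "'b \<Rightarrow> 'a \<Rightarrow> 'b"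
    and alp :: "nat \<Rightarrow> 'a" and gam :: "nat \<Rightarrow> nat \<Rightarrow> 'b"
    and atl :: "t0 \<Rightarrow> 'a" and gt :: "t1 \<Rightarrow> 'b"
    and sm sp tm tp :: real and X :: "nat \<Rightarrow> real \<times> real \<Rightarrow> real"
  assumes "xmod_banach dA l r"
    and "two_connection d dA alp gam"
    and "ext_morphism d dA l r alp gam atl gt"
    and "sm \<le> sp" and "tm \<le> tp"
    and "smooth_surface d sm sp tm tp X"
  shows "Hhat d alp gam l r sm sp tm tp X = uext gt (Rhat d sm sp tm tp X)"
proof -
  interpret surface_morphism d sm sp tm tp X dA l r alp gam atl gt
    by unfold_locales (use assms in auto)
  show ?thesis by (simp add: Hhat_eq Rhat_eq uext_def)
qed

end
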